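(* Let $\hat r>0$ and suppose that $f$ and $\partial f/\partial x_j$ ($j=1,\dots,d$) are continuous on $\{x\in\mathbb{R}^d:\|x\|\le\hat r\}$. Let $A(\cdot)$ and $B(\cdot)$ be continuous, with $f(x)=A(x)x$, and assume that $(A(x),B(x))$ is stabilizable and $(A(x),Q^{1/2})$ is detectable for every $x$ in some neighborhood $\mathcal{O}\subseteq B_{\hat r}(0)$ of the origin. Let $V$ be the optimal value function, $V_S(x)=x^\top P(x)x$ its SDRE approximation, and $E$ the residual (all defined in the context). Let $y^*(\cdot)=y^*(\cdot;x)$ denote the state trajectory starting at $x$ corresponding to the optimal feedback control $u^*(x)=-\frac12R^{-1}B(x)^\top\nabla V(x)$, and $\tilde y_S(\cdot)=\tilde y_S(\cdot;x)$ the state trajectory starting at $x$ corresponding to the feedback control $\tilde u_S(x)=-\frac12R^{-1}B(x)^\top\nabla V_S(x)$. (i) There is a neighborhood of the origin such that for all $x$ in it $$|V_S(x)-V(x)|\le\max\Bigl\{\int_0^\infty|E(y^*(t;x))|\,dt,\ \int_0^\infty|E(\tilde y_S(t;x))|\,dt\Bigr\}.$$ (ii) Assume furthermore that both controlled trajectories are exponentially stable and remain in a neighborhood $\Omega$ of the origin, i.e. there are $C_0>0$ and $\lambda>0$ such that for every $x\in\Omega$ and $t\ge0$ one has $y^*(t;x),\tilde y_S(t;x)\in\Omega$, $\|y^*(t;x)\|\le C_0e^{-\lambda t}\|x\|$ and $\|\tilde y_S(t;x)\|\le C_0e^{-\lambda t}\|x\|$. Then there exists a constant $C>0$ such that $$|V_S(x)-V(x)|\le\frac{C}{\lambda}\,\|E\|_{*,\Omega}\,\|x\|,\qquad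 x\in\Omega,$$ where $\|E\|_{*,\Omega}:=\sup_{z\in\Omega\setminus\{0\}}\frac{|E(z)|}{\|z\|}$.
   Context: The control system is $\dot y(s)=f(y(s))+B(y(s))u(s)$, $s\in(0,+\infty)$, $y(0)=x\in\mathbb{R}^d$, with $f:\mathbb{R}^d\to\mathbb{R}^d$, $B:\mathbb{R}^d\to\mathbb{R}^{d\times m}$ continuously differentiable, $f(0)=0$, and admissible controls $\mathcal{U}=L^\infty([0,+\infty);\mathbb{R}^m)$. The cost is $J(u(\cdot;x))=\int_0^{+\infty}\bigl(y(s)^\top Qy(s)+u(s)^\top Ru(s)\bigr)ds$, with $Q\in\mathbb{R}^{d\times d}$ symmetric positive semidefinite and $R\in\mathbb{R}^{m\times m}$ symmetric positive definite, and the value function is $V(x)=\inf_{u\in\mathcal{U}}J(u(\cdot;x))$. Standing assumption on the optimal feedback: there is an open neighborhood $D$ of the origin on which $V$ is finite and continuously differentiable, and for each $x\in D$ the closed-loop system $\dot y=f(y)+B(y)u^*(y)$, $y(0)=x$, has a solution $y^*(\cdot;x)$ that stays in $D$ for all $t\ge0$, whose control $t\mapsto u^*(y^*(t;x))$ belongs to $\mathcal{U}$ and attains the infimum $V(x)$. A pair $(A,B)$ is stabilizable if $A-BK$ has all its eigenvalues in the open left half plane for some matrix $K$; $(A,C)$ is detectable if $(A^\top,C^\top)$ is stabilizable. For $x\in\mathcal{O}$, $P(x)$ is the unique symmetric positive semidefinite solution of the State-Dependent Riccati Equation $$A^\top(x)P(x)+P(x)A(x)-P(x)B(x)R^{-1}B^\top(x)P(x)+Q=0,$$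 and $P$ is assumed continuously differentiable on $\mathcal{O}$. Put $V_S(x)=x^\top P(x)x$, $[\varphi(x)]_i=x^\top\frac{\partial P(x)}{\partial x_i}x$ for $i=1,\dots,d$ (so $\nabla V_S(x)=2P(x)x+\varphi(x)$), and define the residual $$E(x)=\varphi(x)^\top\Bigl(\bigl[A(x)-B(x)R^{-1}B(x)^\top P(x)\bigr]x-\tfrac14B(x)R^{-1}B(x)^\top\varphi(x)\Bigr).$$ The neighborhood $\Omega$ is contained in $\mathcal{O}\cap D$, so that all quantities are defined on it. *)

theory Defs
  imports "HOL-Analysis.Analysis"
begin

definition psd :: "real^'n^'n \<Rightarrow> bool" where
  "psd M \<longleftrightarrow> transpose M = M \<and> (\<forall>x. 0 \<le> x \<bullet> (M *v x))"

definition posdef :: "real^'n^'n \<Rightarrow> bool" where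
  "posdef M \<longleftrightarrow> transpose M = M \<and> (\<forall>x. x \<noteq> 0 \<longrightarrow> 0 < x \<bullet> (M *v x))"

definition cmatrix :: "real^'n^'m \<Rightarrow> complex^'n^'m" where
  "cmatrix M = (\<chi> i j. complex_of_real (M $ i $ j))"

definition is_eigenvalue :: "real^'n^'n \<Rightarrow> complex \<Rightarrow> bool" where
  "is_eigenvalue M \<mu> \<longleftrightarrow> (\<exists>v. v \<noteq> 0 \<and> cmatrix M *v v = \<mu> *s v)"

definition stabilizable :: "real^'d^'d \<Rightarrow> real^'m^'d \<Rightarrow> bool" where
  "stabilizable A B \<longleftrightarrow> (\<exists>K. \<forall>\<mu>. is_eigenvalue (A - B ** K) \<mu> \<longrightarrow> Re \<mu> < 0)"

definition detectable :: "real^'d^'d \<Rightarrow> real^'d^'p \<Rightarrow> bool" where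
  "detectable A C \<longleftrightarrow> stabilizable (transpose A) (transpose C)"

definition C1_on :: "'a::euclidean_space set \<Rightarrow> ('a \<Rightarrow> 'b::euclidean_space) \<Rightarrow> bool" where
  "C1_on S g \<longleftrightarrow> (\<exists>g' :: 'a \<Rightarrow> 'a \<Rightarrow>\<^sub>L 'b.
     (\<forall>x\<in>S. (g has_derivative blinfun_apply (g' x)) (at x)) \<and> continuous_on S g')"

text \<open>Meaningful only where \<open>g\<close> is differentiable; it is then the unique vector
  representing the derivative.\<close>

definition grad :: "(real^'d \<Rightarrow> real) \<Rightarrow> real^'d \<Rightarrow> real^'d" where
  "grad g x = (THE v. GDERIV g x :> v)"

definition pderivative :: "(real^'d \<Rightarrow> 'b::real_normed_vector) \<Rightarrow> 'd \<Rightarrow> real^'d \<Rightarrow> 'b" where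
  "pderivative g i x = frechet_derivative g (at x) (axis i 1)"

definition admissible :: "(real \<Rightarrow> real^'m) \<Rightarrow> bool" where
  "admissible u \<longleftrightarrow> u \<in> borel_measurable (lebesgue_on {0..}) \<and>
     (\<exists>M. AE s in lebesgue_on {0..}. norm (u s) \<le> M)"

text \<open>Controls are only essentially bounded, so the state equation is read in the
  Caratheodory sense (integrated form). Only the values of \<open>u\<close> and \<open>y\<close> on \<open>{0..}\<close> matter.\<close>

definition state_trajectory ::
  "(real^'d \<Rightarrow> real^'d) \<Rightarrow> (real^'d \<Rightarrow> real^'m^'d) \<Rightarrow> real^'d \<Rightarrow> (real \<Rightarrow> real^'m) \<Rightarrow> (real \<Rightarrow> real^'d) \<Rightarrow> bool"
where
  "state_trajectory f B x u y \<longleftrightarrow> continuous_on {0..} y \<and>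
     (\<forall>t\<ge>0. ((\<lambda>s. f (y s) + B (y s) *v u s) has_integral (y t - x)) {0..t})"

definition cost ::
  "real^'d^'d \<Rightarrow> real^'m^'m \<Rightarrow> (real \<Rightarrow> real^'d) \<Rightarrow> (real \<Rightarrow> real^'m) \<Rightarrow> ennreal"
where
  "cost Q R y u = (\<integral>\<^sup>+s\<in>{0..}. ennreal (y s \<bullet> (Q *v y s) + u s \<bullet> (R *v u s)) \<partial>lebesgue)"

text \<open>For \<open>f\<close> and \<open>B\<close> of class \<open>C\<^sup>1\<close> the trajectory belonging to a control is unique, so the infimum
  over pairs below is the infimum over controls; a control without a trajectory on all of
  \<open>{0..}\<close> counts as having infinite cost. The running cost is nonnegative, so all values are taken in
  \<open>ennreal\<close>; converting with \<open>enn2real\<close> is meaningful only where the value is finite.\<close>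

definition value_function ::
  "(real^'d \<Rightarrow> real^'d) \<Rightarrow> (real^'d \<Rightarrow> real^'m^'d) \<Rightarrow> real^'d^'d \<Rightarrow> real^'m^'m \<Rightarrow> real^'d \<Rightarrow> ennreal"
where
  "value_function f B Q R x =
     Inf {cost Q R y u | y u. admissible u \<and> state_trajectory f B x u y}"

definition feedback ::
  "(real^'d \<Rightarrow> real^'m^'d) \<Rightarrow> real^'m^'m \<Rightarrow> (real^'d \<Rightarrow> real) \<Rightarrow> real^'d \<Rightarrow> real^'m"
where
  "feedback B R W x = - (1/2) *\<^sub>R (matrix_inv R *v (transpose (B x) *v grad W x))"

text \<open>A feedback law given on \<open>S\<close> only determines the motion while it remains in \<open>S\<close>, hence the
  condition \<open>y t \<in> S\<close>. The feedback laws of interest are merely continuous, so the solution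
  need not be unique.\<close>

definition closed_loop_trajectory ::
  "(real^'d \<Rightarrow> real^'d) \<Rightarrow> (real^'d \<Rightarrow> real^'m^'d) \<Rightarrow> (real^'d \<Rightarrow> real^'m) \<Rightarrow> (real^'d) set
     \<Rightarrow> real^'d \<Rightarrow> (real \<Rightarrow> real^'d) \<Rightarrow> bool"
where
  "closed_loop_trajectory f B \<kappa> S x y \<longleftrightarrow> y 0 = x \<and>
     (\<forall>t\<ge>0. y t \<in> S \<and>
        (y has_vector_derivative (f (y t) + B (y t) *v \<kappa> (y t))) (at t within {0..}))"

definition riccati ::
  "real^'d^'d \<Rightarrow> real^'m^'d \<Rightarrow> real^'d^'d \<Rightarrow> real^'m^'m \<Rightarrow> real^'d^'d \<Rightarrow> real^'d^'d"
where
  "riccati A B Q R X =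
     transpose A ** X + X ** A - X ** B ** matrix_inv R ** transpose B ** X + Q"

definition sdre_value :: "(real^'d \<Rightarrow> real^'d^'d) \<Rightarrow> real^'d \<Rightarrow> real" where
  "sdre_value P x = x \<bullet> (P x *v x)"

definition phi :: "(real^'d \<Rightarrow> real^'d^'d) \<Rightarrow> real^'d \<Rightarrow> real^'d" where
  "phi P x = (\<chi> i. x \<bullet> (pderivative P i x *v x))"

definition residual ::
  "(real^'d \<Rightarrow> real^'d^'d) \<Rightarrow> (real^'d \<Rightarrow> real^'m^'d) \<Rightarrow> real^'m^'m \<Rightarrow> (real^'d \<Rightarrow> real^'d^'d)
     \<Rightarrow> real^'d \<Rightarrow> real"
where
  "residual A B R P x = phi P x \<bullet>
     ((A x - B x ** matrix_inv R ** transpose (B x) ** P x) *v x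
      - (1/4) *\<^sub>R ((B x ** matrix_inv R ** transpose (B x)) *v phi P x))"

text \<open>The supremum may be infinite.\<close>

definition weighted_sup :: "(real^'d) set \<Rightarrow> (real^'d \<Rightarrow> real) \<Rightarrow> ennreal" where
  "weighted_sup S g = (SUP z\<in>S - {0}. ennreal (\<bar>g z\<bar> / norm z))"

end

(*
  For every control u and every state y in the domain of P, completing the square gives
    grad VS(y) . (f(y) + B(y) u) + y'Qy + u'Ru = E(y) + (u - uS(y))' R (u - uS(y)),
  because the Riccati equation reduces the minimum over u to the residual E. Integrated along the
  optimal trajectory this yields VS(x) <= V(x) + int |E(ystar)| once ystar comes arbitrarily close to 0,
  and along the SDRE trajectory it bounds the cost of uS, hence V(x), by VS(x) + int |E(yS)|. So no
  Hamilton-Jacobi-Bellman equation for V is needed.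

  Both kinds of trajectories stay near 0 for one reason. By detectability at 0 there are L and a
  quadratic form Z decaying along A(0) - L Q^(1/2); near 0 and for every control,
  dZ/dt <= -c |y|^2 + k (y'Qy + u'Ru). The accumulated running cost is at most V(x) along ystar, and
  along yS it is at most VS(x) + int |E| with |E(y)| = o(|y|^2). Both bounds are small near 0, so Z
  stays below its minimum on a small sphere; the same estimate forces int |ystar|^2 < infinity.

  The feedback uS is only continuous, so yS is obtained from Peano's theorem.
*)
theory Submission
  imports Defs "HOL-Computational_Algebra.Fundamental_Theorem_Algebra"
    "HOL-Complex_Analysis.Great_Picard"
begin

section \<open>Lyapunov forms of Hurwitz matrices\<close>

text \<open>The dissipation inequality for Z holds only in a ball on which \<open>A\<close> is close
  to \<open>A 0\<close> and \<open>B\<close> is bounded, while \<open>ystar\<close> is known a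
  priori only to stay in \<open>D\<close>, which need not lie in \<open>\<O>\<close>. Each estimate
  is therefore made on intervals [0,T] during which the state is in the closed ball, and a
  first-exit argument (\<open>norm_trapped\<close>) removes the restriction. The constants are
  matched: \<open>k * \<bar>E y\<bar> \<le> c * (norm y)\<^sup>2\<close> near 0, so along the SDRE
  trajectory the decay of Z cancels the contribution of the residual to the cost, and the bound that
  remains does not grow with time.

  The form Z is built algebraically: a flag of invariant spaces of complex functionals is climbed
  one dimension at a time, each step adding a small multiple of the squared modulus of one
  functional. The spectral input is a root of a complex polynomial.

  As the closed loop of \<open>uS\<close> may have several solutions, the bounds are proved for
  every solution and existence is shown separately. For it the field is composed with the projection
  onto the ball; by trapping, the solution never meets the modification.\<close>

lemma family_dependent:
  fixes g :: "nat \<Rightarrow> 'a::euclidean_space"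
  assumes n: "DIM('a) \<le> n"
  obtains c :: "nat \<Rightarrow> real" and k where "k \<le> n" "c k \<noteq> 0" "(\<Sum>i\<le>n. c i *\<^sub>R g i) = 0"
proof (cases "inj_on g {..n}")
  case True
  then have "card (g ` {..n}) > DIM('a)"
    using n by (simp add: card_image)
  then have "dependent (g ` {..n})"
    by (simp add: dependent_biggerset)
  then obtain u where u: "\<exists>v\<in>g ` {..n}. u v \<noteq> (0::real)" "(\<Sum>v\<in>g ` {..n}. u v *\<^sub>R v) = 0"
    using dependent_finite[of "g ` {..n}"] by auto
  show ?thesis
    using u that[of _ "\<lambda>i. u (g i)"] by (auto simp: sum.reindex[OF True])
next
  case False
  then obtain i j where ij: "i \<le> n" "j \<le> n" "i \<noteq> j" "g i = g j"
    by (auto simp: inj_on_def)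
  \<comment> \<open>A repeated vector makes the set too small for the dimension count; the relation
    is then g i - g j = 0.\<close>
  let ?c = "\<lambda>k. (if k = i then 1 else 0) - (if k = j then 1 else (0::real))"
  have "(\<Sum>k\<le>n. ?c k *\<^sub>R g k) = (\<Sum>k\<le>n. if k = i then g k else 0) - (\<Sum>k\<le>n. if k = j then g k else 0)"
    unfolding sum_subtractf[symmetric] by (rule sum.cong) auto
  also have "\<dots> = 0"
    using ij by simp
  finally show ?thesis
    using ij that[of i ?c] by simp
qed

text \<open>This is p(G) w, with iterates of the map in place of matrix powers.\<close>

definition poly_orbit :: "complex^'n^'n \<Rightarrow> complex^'n \<Rightarrow> complex poly \<Rightarrow> complex^'n" where
  "poly_orbit G w p = (\<Sum>i\<le>degree p. coeff p i *s (((*v) G ^^ i) w))"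

lemma poly_orbit_altdef:
  assumes "degree p \<le> n"
  shows "poly_orbit G w p = (\<Sum>i\<le>n. coeff p i *s (((*v) G ^^ i) w))"
  unfolding poly_orbit_def
  by (rule sum.mono_neutral_left) (use assms in \<open>auto simp: coeff_eq_0\<close>)

lemma poly_orbit_add: "poly_orbit G w (p + q) = poly_orbit G w p + poly_orbit G w q"
proof -
  let ?n = "max (degree p) (degree q)"
  have "degree (p + q) \<le> ?n"
    by (rule degree_add_le_max)
  then show ?thesis
    by (simp add: poly_orbit_altdef[of _ ?n] sum.distrib vector_sadd_rdistrib)
qed

lemma poly_orbit_smult: "poly_orbit G w (smult a p) = a *s poly_orbit G w p"
  by (simp add: poly_orbit_altdef[of _ "degree p"] vec.scale_sum_right vector_smult_assoc)

text \<open>With additivity and homogeneity this turns a factor X - \<mu> of a polynomial into the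
  operator G - \<mu>.\<close>

lemma poly_orbit_pCons_0: "poly_orbit G w (pCons 0 p) = G *v poly_orbit G w p"
proof -
  have "poly_orbit G w (pCons 0 p) = (\<Sum>i\<le>Suc (degree p). coeff (pCons 0 p) i *s (((*v) G ^^ i) w))"
    by (rule poly_orbit_altdef) (rule degree_pCons_le)
  also have "\<dots> = (\<Sum>i\<le>degree p. coeff p i *s (G *v (((*v) G ^^ i) w)))"
    by (simp add: sum.atMost_Suc_shift del: sum.atMost_Suc)
  also have "\<dots> = G *v poly_orbit G w p"
    by (simp add: poly_orbit_def vec.linear_sum vec.sum vector_scalar_commute)
  finally show ?thesis .
qed

lemma of_real_vector_smult: "complex_of_real a *s x = a *\<^sub>R x"
  unfolding vec_eq_iff vector_scaleR_component vector_smult_component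
  by (simp add: scaleR_conv_of_real)

text \<open>Take a nonzero polynomial p of least degree with p(G) w in S. It has a root \<mu>, and
  for p = (X - \<mu>) q minimality puts v = q(G) w outside S, while (G - \<mu>) v = p(G) w lies in
  S.\<close>

lemma eigenvector_modulo_subspace:
  fixes G :: "complex^'n^'n"
  assumes S: "vec.subspace S" and w: "w \<notin> S"
  obtains v \<mu> where "v \<notin> S" "G *v v - \<mu> *s v \<in> S"
proof -
  \<comment> \<open>\<open>DIM\<close> counts real dimensions; the real relation found among the
    iterates also serves as a complex one.\<close>
  let ?n = "DIM(complex^'n)"
  obtain c :: "nat \<Rightarrow> real" and k where k: "k \<le> ?n" "c k \<noteq> 0"
    and c: "(\<Sum>i\<le>?n. c i *\<^sub>R (((*v) G ^^ i) w)) = 0"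
    using family_dependent[of ?n "\<lambda>i. ((*v) G ^^ i) w"] by blast
  define p0 where "p0 = (\<Sum>i\<le>?n. monom (complex_of_real (c i)) i)"
  have cf: "coeff p0 j = (if j \<le> ?n then complex_of_real (c j) else 0)" for j
    by (auto simp: p0_def coeff_sum)
  have "degree p0 \<le> ?n"
    by (rule degree_le) (simp add: cf)
  then have "poly_orbit G w p0 = (\<Sum>i\<le>?n. c i *\<^sub>R (((*v) G ^^ i) w))"
    by (simp add: poly_orbit_altdef[of _ ?n] cf of_real_vector_smult)
  then have p0: "p0 \<noteq> 0" "poly_orbit G w p0 \<in> S"
    using k cf[of k] c vec.subspace_0[OF S] by auto
  obtain p where p: "p \<noteq> 0" "poly_orbit G w p \<in> S"
    and least: "\<And>q. q \<noteq> 0 \<Longrightarrow> poly_orbit G w q \<in> S \<Longrightarrow> degree p \<le> degree q"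
    using ex_has_least_nat[of "\<lambda>p. p \<noteq> 0 \<and> poly_orbit G w p \<in> S" p0 degree] p0 by blast
  \<comment> \<open>A nonzero constant a would put a w, and hence w, into S.\<close>
  have "degree p \<noteq> 0"
  proof
    assume "degree p = 0"
    then obtain a where a: "p = [:a:]"
      by (metis degree_eq_zeroE)
    then have "a \<noteq> 0" "a *s w \<in> S"
      using p by (auto simp: poly_orbit_def)
    then have "(1/a) *s (a *s w) \<in> S"
      using vec.subspace_scale[OF S] by blast
    then show False
      using \<open>a \<noteq> 0\<close> w by (simp add: vector_smult_assoc)
  qed
  then obtain \<mu> where "poly p \<mu> = 0"
    using Fundamental_Theorem_Algebra.fundamental_theorem_of_algebra[of p] by (auto simp: constant_degree)
  then obtain q where q: "p = [:- \<mu>, 1:] * q"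
    by (auto simp: poly_eq_0_iff_dvd elim: dvdE)
  have "q \<noteq> 0"
    using p q by auto
  then have "degree p = Suc (degree q)"
    using degree_mult_eq[of "[:- \<mu>, 1:]" q] by (simp add: q del: mult_pCons_left)
  then have "poly_orbit G w q \<notin> S"
    using least[of q] \<open>q \<noteq> 0\<close> by auto
  moreover have "p = pCons 0 q + smult (- \<mu>) q"
    by (simp add: q)
  then have "poly_orbit G w p = G *v poly_orbit G w q - \<mu> *s poly_orbit G w q"
    by (simp only: poly_orbit_add poly_orbit_smult poly_orbit_pCons_0) (simp add: vec_eq_iff)
  ultimately show ?thesis
    using p that by metis
qed

text \<open>G - \<mu> maps the span of v and S into S, whose dimension is one less, so it has a
  kernel there. An eigenvalue found modulo S is thus an eigenvalue of G, to which the Hurwitz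
  hypothesis applies.\<close>

lemma eigenvalue_of_flag_step:
  fixes G :: "complex^'n^'n"
  assumes S: "vec.subspace S" and inv: "\<And>s. s \<in> S \<Longrightarrow> G *v s \<in> S"
    and v: "v \<notin> S" "G *v v - \<mu> *s v \<in> S"
  obtains z where "z \<noteq> 0" "G *v z = \<mu> *s z"
proof -
  let ?T = "vec.span (insert v S)" and ?h = "\<lambda>x. (G - mat \<mu>) *v x"
  have h: "?h x = G *v x - \<mu> *s x" for x
    by (simp add: matrix_vector_mult_diff_rdistrib) 
       (simp add: mat_def matrix_vector_mult_def vec_eq_iff if_distrib if_distribR cong: if_cong)
  have "?h ` insert v S \<subseteq> S"
    using v inv vec.subspace_diff[OF S] vec.subspace_scale[OF S] by (auto simp: h)
  then have "vec.dim (?h ` insert v S) \<le> vec.dim S"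
    by (rule vec.dim_subset)
  moreover have "vec.dim (insert v S) = vec.dim S + 1"
    using v by (simp add: vec.dim_insert vec.span_eq_iff[THEN iffD2, OF S])
  ultimately have "\<not> inj_on ?h ?T"
    using vec.dim_image_eq[OF matrix_vector_mul_linear_gen, of "G - mat \<mu>" "insert v S"] by auto
  then obtain x y where "x \<noteq> y" "?h x = ?h y"
    by (auto simp: inj_on_def)
  then have "?h (x - y) = 0" "x - y \<noteq> 0"
    by (auto simp: matrix_vector_mult_diff_distrib)
  then show ?thesis
    using that[of "x - y"] by (auto simp: h)
qed

text \<open>Complex functionals on real states, given by coefficient vectors. Without conjugation
  the pairing is complex linear in the functional, and by \<open>pairing_adjoint\<close> G acts on
  functionals as its transpose acts on states; hence the transposes in the Lyapunov
  statements.\<close>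

definition pairing :: "complex^'n \<Rightarrow> real^'n \<Rightarrow> complex" where
  "pairing s x = (\<Sum>i\<in>UNIV. s $ i * complex_of_real (x $ i))"

lemma pairing_diff: "pairing (s - t) x = pairing s x - pairing t x"
  by (simp add: pairing_def algebra_simps sum_subtractf)

lemma pairing_scale: "pairing (a *s s) x = a * pairing s x"
  by (simp add: pairing_def algebra_simps sum_distrib_left)

lemma pairing_axis: "pairing (axis i 1) x = complex_of_real (x $ i)"
  by (simp add: pairing_def axis_def if_distrib if_distribR cong: if_cong)

lemma pairing_adjoint: "pairing (cmatrix G *v s) x = pairing s (transpose G *v x)"
proof -
  have "pairing (cmatrix G *v s) x = (\<Sum>i\<in>UNIV. \<Sum>j\<in>UNIV. complex_of_real (G $ i $ j) * s $ j * complex_of_real (x $ i))"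
    by (simp add: pairing_def cmatrix_def matrix_vector_mult_def sum_distrib_right)
  also have "\<dots> = (\<Sum>j\<in>UNIV. \<Sum>i\<in>UNIV. complex_of_real (G $ i $ j) * s $ j * complex_of_real (x $ i))"
    by (rule sum.swap)
  also have "\<dots> = pairing s (transpose G *v x)"
    by (simp add: pairing_def transpose_def matrix_vector_mult_def sum_distrib_left mult_ac)
  finally show ?thesis .
qed

lemma Re_pairing: "Re (pairing s x) = (\<chi> i. Re (s $ i)) \<bullet> x"
  by (simp add: pairing_def inner_vec_def)

lemma Im_pairing: "Im (pairing s x) = (\<chi> i. Im (s $ i)) \<bullet> x"
  by (simp add: pairing_def inner_vec_def)

text \<open>The form is built along a flag of \<open>G\<close>-invariant spaces of complex functionals: if
  \<open>G v - \<mu> v\<close> lies in the previous space, then adding a small multiple of \<open>|v x|\<^sup>2\<close> to the form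
  keeps it decaying, since the cross term is absorbed by the decay already available.\<close>

lemma lyapunov_of_flag:
  fixes G :: "real^'n^'n"
  assumes hurwitz: "\<And>\<mu>. is_eigenvalue G \<mu> \<Longrightarrow> Re \<mu> < 0" and "k \<le> CARD('n)"
  shows "\<exists>S m c. vec.subspace S \<and> k \<le> vec.dim S \<and> (\<forall>s\<in>S. cmatrix G *v s \<in> S) \<and>
    linear m \<and> (\<forall>x y. x \<bullet> m y = m x \<bullet> y) \<and> c > 0 \<and>
    (\<forall>x. x \<bullet> m (transpose G *v x) \<le> - c * (x \<bullet> m x)) \<and>
    (\<forall>s\<in>S. \<exists>K>0. \<forall>x. (norm (pairing s x))\<^sup>2 \<le> K * (x \<bullet> m x))"
  using \<open>k \<le> CARD('n)\<close>
proof (induction k)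
  case 0
  \<comment> \<open>The zero form dominates the zero functional; definiteness is reached only once S
    is the whole space.\<close>
  show ?case
  proof (intro exI conjI)
    show "vec.subspace {0::complex^'n}"
      by (rule vec.subspace_single_0)
    show "linear (\<lambda>x::real^'n. 0::real^'n)"
      by (rule linear_zero)
    show "\<forall>s\<in>{0}. \<exists>K>0. \<forall>x::real^'n. (norm (pairing s x))\<^sup>2 \<le> K * (x \<bullet> 0)"
      by (auto simp: pairing_def intro: exI[of _ 1])
    show "(0::real) < 1" by simp
  qed auto
next
  case (Suc k)
  then obtain S m c where S: "vec.subspace S" "k \<le> vec.dim S" and inv: "\<And>s. s \<in> S \<Longrightarrow> cmatrix G *v s \<in> S"
    and m: "linear m" "\<And>x y. x \<bullet> m y = m x \<bullet> y" and c: "c > 0"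
    and decay: "\<And>x. x \<bullet> m (transpose G *v x) \<le> - c * (x \<bullet> m x)"
    and dom: "\<And>s. s \<in> S \<Longrightarrow> \<exists>K>0. \<forall>x. (norm (pairing s x))\<^sup>2 \<le> K * (x \<bullet> m x)"
    by auto
  show ?case
  proof (cases "S = UNIV")
    case True
    then have "Suc k \<le> vec.dim S"
      using Suc.prems vec_dim_card[where 'a=complex and 'n='n] by simp
    then show ?thesis
      using S inv m c decay dom by blast
  next
    case False
    then obtain w where "w \<notin> S"
      by auto
    then obtain v \<mu> where v: "v \<notin> S" "cmatrix G *v v - \<mu> *s v \<in> S"
      using eigenvector_modulo_subspace[OF S(1)] by blast
    obtain z where "z \<noteq> 0" "cmatrix G *v z = \<mu> *s z"
      using eigenvalue_of_flag_step[OF S(1) inv v] by blast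
    then have "Re \<mu> < 0"
      using hurwitz by (auto simp: is_eigenvalue_def)
    define \<alpha> where "\<alpha> = - Re \<mu>"
    have \<alpha>: "\<alpha> > 0"
      using \<open>Re \<mu> < 0\<close> by (simp add: \<alpha>_def)
    define s0 where "s0 = cmatrix G *v v - \<mu> *s v"
    obtain K where K: "K > 0" "\<And>x. (norm (pairing s0 x))\<^sup>2 \<le> K * (x \<bullet> m x)"
      using dom[OF v(2)] unfolding s0_def by blast
    \<comment> \<open>Nonnegativity of the form is not carried through the induction; it follows
      from the domination of any one functional, here \<open>s0\<close>.\<close>
    have mpos: "0 \<le> x \<bullet> m x" for x
      using K zero_le_mult_iff[of K "x \<bullet> m x"] order_trans[OF zero_le_power2 K(2)] by auto
    define a b where "a = (\<chi> i. Re (v $ i))" and "b = (\<chi> i. Im (v $ i))"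
    have nv: "(norm (pairing v x))\<^sup>2 = (a \<bullet> x)\<^sup>2 + (b \<bullet> x)\<^sup>2" for x
      by (simp add: cmod_power2 Re_pairing Im_pairing a_def b_def)
    \<comment> \<open>With this choice the cross term contributes \<epsilon> K / (2 \<alpha>) = c/2
      times the old form, half of its decay.\<close>
    define \<epsilon> where "\<epsilon> = c * \<alpha> / K"
    have \<epsilon>: "\<epsilon> > 0"
      using c \<alpha> K by (simp add: \<epsilon>_def)
    define m' where "m' = (\<lambda>x. m x + \<epsilon> *\<^sub>R ((a \<bullet> x) *\<^sub>R a + (b \<bullet> x) *\<^sub>R b))"
    have m'_quad: "x \<bullet> m' x = x \<bullet> m x + \<epsilon> * (norm (pairing v x))\<^sup>2" for x
      by (simp add: m'_def nv inner_add_right inner_commute) (simp add: power2_eq_square)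
    define c' where "c' = min (c/2) (\<alpha>/2)"
    have c': "c' > 0" "c' \<le> c/2" "c' \<le> \<alpha>/2"
      using c \<alpha> by (auto simp: c'_def)
    \<comment> \<open>Half the derivative of |v x|^2 along the transposed system: the functional v
      evolves by \<mu> v + s0, and Young's inequality with weight \<alpha> splits the product with
      s0.\<close>
    have step: "(a \<bullet> x) * (a \<bullet> (transpose G *v x)) + (b \<bullet> x) * (b \<bullet> (transpose G *v x))
        \<le> - (\<alpha>/2) * (norm (pairing v x))\<^sup>2 + K / (2*\<alpha>) * (x \<bullet> m x)" for x
    proof -
      let ?p = "pairing v x" and ?s = "pairing s0 x"
      have "pairing v (transpose G *v x) = \<mu> * ?p + ?s"
        unfolding pairing_adjoint[symmetric] by (simp add: s0_def pairing_diff pairing_scale)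
      moreover have "(a \<bullet> x) * (a \<bullet> (transpose G *v x)) + (b \<bullet> x) * (b \<bullet> (transpose G *v x))
          = Re (cnj ?p * pairing v (transpose G *v x))"
        by (simp add: Re_pairing Im_pairing a_def b_def)
      moreover have "Re (cnj ?p * (\<mu> * ?p + ?s)) = - \<alpha> * (norm ?p)\<^sup>2 + Re (cnj ?p * ?s)"
        unfolding cmod_power2 by (simp add: \<alpha>_def algebra_simps power2_eq_square)
      moreover have "Re (cnj ?p * ?s) \<le> norm ?p * norm ?s"
        using complex_Re_le_cmod[of "cnj ?p * ?s"] by (simp add: norm_mult)
      moreover have "norm ?p * norm ?s \<le> \<alpha>/2 * (norm ?p)\<^sup>2 + 1/(2*\<alpha>) * (norm ?s)\<^sup>2"
      proof -
        have "0 \<le> (\<alpha> * norm ?p - norm ?s)\<^sup>2 / (2 * \<alpha>)"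
          using \<alpha> by simp
        also have "\<dots> = \<alpha>/2 * (norm ?p)\<^sup>2 + 1/(2*\<alpha>) * (norm ?s)\<^sup>2 - norm ?p * norm ?s"
          using \<alpha> by (simp add: power2_diff field_simps power2_eq_square)
        finally show ?thesis by simp
      qed
      moreover have "1/(2*\<alpha>) * (norm ?s)\<^sup>2 \<le> 1/(2*\<alpha>) * (K * (x \<bullet> m x))"
        using K \<alpha> by (intro mult_left_mono) auto
      ultimately show ?thesis
        by simp
    qed
    let ?S = "vec.span (insert v S)"
    have "Suc k \<le> vec.dim ?S"
      using S v by (simp add: vec.dim_insert vec.span_eq_iff[THEN iffD2, OF S(1)])
    moreover have "cmatrix G *v s \<in> ?S" if "s \<in> ?S" for s
    proof -
      obtain k where "s - k *s v \<in> S"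
        using \<open>s \<in> ?S\<close> vec.span_eq_iff[THEN iffD2, OF S(1)] by (auto simp: vec.span_insert)
      then have "cmatrix G *v (s - k *s v) + k *s (cmatrix G *v v - \<mu> *s v) \<in> S"
        using inv v S vec.subspace_add vec.subspace_scale by blast
      then have "cmatrix G *v (s - k *s v) + k *s (cmatrix G *v v - \<mu> *s v) + (k * \<mu>) *s v \<in> ?S"
        by (meson vec.span_add vec.span_base vec.span_scale insertI1 insertI2)
      moreover have "cmatrix G *v (s - k *s v) + k *s (cmatrix G *v v - \<mu> *s v) + (k * \<mu>) *s v = cmatrix G *v s"
        by (simp add: matrix_vector_mult_diff_distrib vector_scalar_commute vector_smult_assoc vec.scale_right_diff_distrib)
      ultimately show ?thesis by simp
    qed
    moreover have "linear m'"
      unfolding m'_def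
      by (intro linear_compose_add m linear_compose_scale_right linear_scaleR_left bounded_linear.linear
            bounded_linear_intros)
    moreover have "x \<bullet> m' y = m' x \<bullet> y" for x y
      using m(2)[of x y] by (simp add: m'_def inner_add_right inner_add_left inner_commute algebra_simps)
    moreover have "x \<bullet> m' (transpose G *v x) \<le> - c' * (x \<bullet> m' x)" for x
    proof -
      have "x \<bullet> m' (transpose G *v x) = x \<bullet> m (transpose G *v x) +
          \<epsilon> * ((a \<bullet> x) * (a \<bullet> (transpose G *v x)) + (b \<bullet> x) * (b \<bullet> (transpose G *v x)))"
        by (simp add: m'_def inner_add_right inner_commute algebra_simps)
      also have "\<dots> \<le> - c * (x \<bullet> m x) + \<epsilon> * (- (\<alpha>/2) * (norm (pairing v x))\<^sup>2 + K / (2*\<alpha>) * (x \<bullet> m x))"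
        using \<epsilon> by (intro add_mono[OF decay] mult_left_mono[OF step]) auto
      also have "\<dots> = - (c/2) * (x \<bullet> m x) - \<alpha>/2 * (\<epsilon> * (norm (pairing v x))\<^sup>2)"
        using \<alpha> K by (simp add: \<epsilon>_def field_simps)
      also have "\<dots> \<le> - c' * (x \<bullet> m x) - c' * (\<epsilon> * (norm (pairing v x))\<^sup>2)"
      proof -
        have "c' * (x \<bullet> m x) \<le> c/2 * (x \<bullet> m x)"
          by (rule mult_right_mono[OF c'(2) mpos])
        moreover have "c' * (\<epsilon> * (norm (pairing v x))\<^sup>2) \<le> \<alpha>/2 * (\<epsilon> * (norm (pairing v x))\<^sup>2)"
          using \<epsilon> by (intro mult_right_mono[OF c'(3)]) simp
        ultimately show ?thesis by linarith
      qed
      finally show ?thesis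
        by (simp add: m'_quad algebra_simps)
    qed
    moreover have "\<exists>K>0. \<forall>x. (norm (pairing s x))\<^sup>2 \<le> K * (x \<bullet> m' x)" if "s \<in> ?S" for s
    proof -
      obtain k where "s - k *s v \<in> S"
        using \<open>s \<in> ?S\<close> vec.span_eq_iff[THEN iffD2, OF S(1)] by (auto simp: vec.span_insert)
      then obtain K' where K': "K' > 0" "\<And>x. (norm (pairing (s - k *s v) x))\<^sup>2 \<le> K' * (x \<bullet> m x)"
        using dom by blast
      \<comment> \<open>The factors 2 come from (a + b)^2 \<le> 2 a^2 + 2 b^2; the division by
        \<epsilon> is due to the weight of |v x|^2 in the new form.\<close>
      let ?K = "2 * K' + 2 * (norm k)\<^sup>2 / \<epsilon>"
      have "(norm (pairing s x))\<^sup>2 \<le> ?K * (x \<bullet> m' x)" for x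
      proof -
        have "(norm (pairing s x))\<^sup>2 = (norm (pairing (s - k *s v) x + k * pairing v x))\<^sup>2"
          by (simp add: pairing_diff pairing_scale)
        also have "\<dots> \<le> (norm (pairing (s - k *s v) x) + norm k * norm (pairing v x))\<^sup>2"
          by (intro power_mono) (auto intro: norm_triangle_le simp: norm_mult)
        also have "\<dots> \<le> 2 * (norm (pairing (s - k *s v) x))\<^sup>2 + 2 * (norm k * norm (pairing v x))\<^sup>2"
          using zero_le_power2[of "norm (pairing (s - k *s v) x) - norm k * norm (pairing v x)"]
          by (simp add: power2_sum power2_diff)
        also have "\<dots> \<le> 2 * K' * (x \<bullet> m x) + 2 * (norm k)\<^sup>2 / \<epsilon> * (\<epsilon> * (norm (pairing v x))\<^sup>2)"
          using K'(2)[of x] \<epsilon> by (simp add: power_mult_distrib)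
        also have "\<dots> \<le> ?K * (x \<bullet> m x) + ?K * (\<epsilon> * (norm (pairing v x))\<^sup>2)"
          using K'(1) \<epsilon> mpos[of x] by (intro add_mono mult_right_mono) auto
        finally show ?thesis
          by (simp add: m'_quad distrib_left)
      qed
      moreover have "?K > 0"
        using K'(1) \<epsilon> by (intro add_pos_nonneg) auto
      ultimately show ?thesis by blast
    qed
    ultimately show ?thesis
      using vec.subspace_span c' by blast
  qed
qed

text \<open>A flag of full dimension is the whole space, so the form dominates every coordinate
  functional and is positive definite. Its relative decay then becomes decay by a multiple of
  |x|^2.\<close>

theorem hurwitz_lyapunov:
  fixes G :: "real^'n^'n"
  assumes hurwitz: "\<And>\<mu>. is_eigenvalue G \<mu> \<Longrightarrow> Re \<mu> < 0"
  obtains m :: "real^'n \<Rightarrow> real^'n" and a c where "linear m" "\<And>x y. x \<bullet> m y = m x \<bullet> y" "a > 0" "c > 0"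
    "\<And>x. a * (norm x)\<^sup>2 \<le> x \<bullet> m x" "\<And>x. x \<bullet> m (transpose G *v x) \<le> - c * (norm x)\<^sup>2"
proof -
  obtain S m c where S: "vec.subspace S" "CARD('n) \<le> vec.dim S"
    and m: "linear m" "\<And>x y. x \<bullet> m y = m x \<bullet> y" and c: "c > 0"
    and decay: "\<And>x. x \<bullet> m (transpose G *v x) \<le> - c * (x \<bullet> m x)"
    and dom: "\<And>s. s \<in> S \<Longrightarrow> \<exists>K>0. \<forall>x. (norm (pairing s x))\<^sup>2 \<le> K * (x \<bullet> m x)"
    using lyapunov_of_flag[of G "CARD('n)", OF hurwitz] by auto
  have "vec.dim S = vec.dim (UNIV :: (complex^'n) set)"
    using S vec.dim_subset_UNIV[of S] vec_dim_card[where 'a=complex and 'n='n] by (simp add: vec.dimension_def)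
  then have "S = UNIV"
    using vec.dim_eq_full[of S] vec.span_eq_iff[THEN iffD2, OF S(1)] vec.dim_eq_full[of UNIV] by auto
  then have "\<forall>i. \<exists>K>0. \<forall>x. (norm (pairing (axis i 1) x))\<^sup>2 \<le> K * (x \<bullet> m x)"
    using dom by blast
  then obtain K where K: "\<And>i. K i > 0" "\<And>i x. (norm (pairing (axis i 1) x))\<^sup>2 \<le> K i * (x \<bullet> m x)"
    by metis
  let ?K = "\<Sum>i\<in>UNIV. K i"
  have "?K > 0"
    using K by (intro sum_pos) auto
  have bound: "(norm x)\<^sup>2 \<le> ?K * (x \<bullet> m x)" for x
  proof -
    have "(norm x)\<^sup>2 = (\<Sum>i\<in>UNIV. (x $ i)\<^sup>2)"
      unfolding power2_norm_eq_inner by (simp add: inner_vec_def power2_eq_square)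
    also have "\<dots> \<le> (\<Sum>i\<in>UNIV. K i * (x \<bullet> m x))"
      using K(2)[of _ x] by (intro sum_mono) (simp add: pairing_axis)
    finally show ?thesis
      by (simp add: sum_distrib_right)
  qed
  have "1 / ?K * (norm x)\<^sup>2 \<le> x \<bullet> m x" for x
    using bound[of x] \<open>?K > 0\<close> by (simp add: field_simps)
  moreover from this have "x \<bullet> m (transpose G *v x) \<le> - (c / ?K) * (norm x)\<^sup>2" for x
    using order_trans[OF decay[of x], of "- (c / ?K) * (norm x)\<^sup>2"] mult_left_mono[of "1 / ?K * (norm x)\<^sup>2" "x \<bullet> m x" c] c by simp
  ultimately show ?thesis
    using that[OF m, of "1 / ?K" "c / ?K"] c \<open>?K > 0\<close> by simp
qed

section \<open>Peano's existence theorem\<close>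

primrec euler_node :: "('a::real_vector \<Rightarrow> 'a) \<Rightarrow> 'a \<Rightarrow> real \<Rightarrow> nat \<Rightarrow> 'a" where
  "euler_node g x h 0 = x"
| "euler_node g x h (Suc k) = euler_node g x h k + h *\<^sub>R g (euler_node g x h k)"

text \<open>The value at the last node not after t. With this step function inside g, the polygon is
  exactly x plus an integral of g, without an error term.\<close>

definition euler_step :: "('a::real_vector \<Rightarrow> 'a) \<Rightarrow> 'a \<Rightarrow> real \<Rightarrow> real \<Rightarrow> 'a" where
  "euler_step g x h t = euler_node g x h (nat \<lfloor>t / h\<rfloor>)"

definition euler_polygon :: "('a::real_vector \<Rightarrow> 'a) \<Rightarrow> 'a \<Rightarrow> real \<Rightarrow> real \<Rightarrow> 'a" where
  "euler_polygon g x h t =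
     euler_step g x h t + (t - h * real (nat \<lfloor>t / h\<rfloor>)) *\<^sub>R g (euler_step g x h t)"

lemma euler_index_bounds:
  assumes "h > 0" "t \<ge> 0"
  shows "h * real (nat \<lfloor>t / h\<rfloor>) \<le> t" "t < h * real (nat \<lfloor>t / h\<rfloor>) + h"
proof -
  have eq: "real (nat \<lfloor>t / h\<rfloor>) = of_int \<lfloor>t / h\<rfloor>"
    using assms by simp
  have "h * of_int \<lfloor>t / h\<rfloor> \<le> h * (t / h)" "h * (t / h) < h * (of_int \<lfloor>t / h\<rfloor> + 1)"
    using \<open>h > 0\<close> by (intro mult_left_mono mult_strict_left_mono; linarith)+
  then show "h * real (nat \<lfloor>t / h\<rfloor>) \<le> t" "t < h * real (nat \<lfloor>t / h\<rfloor>) + h"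
    unfolding eq using \<open>h > 0\<close> by (simp_all add: field_simps)
qed

lemma euler_step_eq_node:
  assumes "h > 0" "h * real k \<le> t" "t < h * real k + h"
  shows "euler_step g x h t = euler_node g x h k"
proof -
  have "\<lfloor>t / h\<rfloor> = int k"
    using assms by (intro floor_unique) (auto simp: field_simps)
  then show ?thesis
    by (simp add: euler_step_def)
qed

lemma euler_piece_has_integral:
  fixes g :: "'a::euclidean_space \<Rightarrow> 'a"
  assumes "h > 0" "h * real k \<le> t" "t \<le> h * real k + h"
  shows "((\<lambda>s. g (euler_step g x h s)) has_integral (t - h * real k) *\<^sub>R g (euler_node g x h k)) {h * real k..t}"
\<comment> \<open>At t = h (k + 1) the index has already jumped to k + 1, so the right end point is
  removed.\<close>
proof (rule has_integral_spike_finite[of "{t}"])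
  show "((\<lambda>s. g (euler_node g x h k)) has_integral (t - h * real k) *\<^sub>R g (euler_node g x h k)) {h * real k..t}"
    using has_integral_const_real[of "g (euler_node g x h k)" "h * real k" t] assms by simp
  show "g (euler_step g x h s) = g (euler_node g x h k)" if "s \<in> {h * real k..t} - {t}" for s
    using that assms by (subst euler_step_eq_node[of h k]) auto
qed simp

lemma euler_has_integral:
  fixes g :: "'a::euclidean_space \<Rightarrow> 'a"
  assumes h: "h > 0" and t: "t \<ge> 0"
  shows "((\<lambda>s. g (euler_step g x h s)) has_integral (euler_polygon g x h t - x)) {0..t}"
proof -
  have nodes: "((\<lambda>s. g (euler_step g x h s)) has_integral (euler_node g x h k - x)) {0..h * real k}" for k
  proof (induction k)
    case 0
    then show ?case
      using has_integral_refl(2)[of "\<lambda>s. g (euler_step g x h s)" 0] by simp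
  next
    case (Suc k)
    have "((\<lambda>s. g (euler_step g x h s)) has_integral
        (euler_node g x h k - x) + (h * real (Suc k) - h * real k) *\<^sub>R g (euler_node g x h k)) {0..h * real (Suc k)}"
      using h by (intro has_integral_combine[OF _ _ Suc.IH euler_piece_has_integral]) (auto simp: algebra_simps)
    then show ?case
      by (simp add: algebra_simps)
  qed
  let ?k = "nat \<lfloor>t / h\<rfloor>"
  have "((\<lambda>s. g (euler_step g x h s)) has_integral
      (euler_node g x h ?k - x) + (t - h * real ?k) *\<^sub>R g (euler_node g x h ?k)) {0..t}"
    using h euler_index_bounds[OF h t]
    by (intro has_integral_combine[OF _ _ nodes euler_piece_has_integral]) auto
  then show ?thesis
    by (simp add: euler_polygon_def euler_step_def algebra_simps)
qed

lemma euler_step_polygon_dist: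
  assumes "h > 0" "t \<ge> 0" and M: "\<And>z. norm (g z) \<le> M"
  shows "norm (euler_step g x h t - euler_polygon g x h t) \<le> h * M"
proof -
  have "norm (euler_step g x h t - euler_polygon g x h t)
      = \<bar>t - h * real (nat \<lfloor>t / h\<rfloor>)\<bar> * norm (g (euler_step g x h t))"
    by (simp add: euler_polygon_def)
  also have "\<dots> \<le> h * M"
    using euler_index_bounds[OF assms(1,2)] M assms by (intro mult_mono) auto
  finally show ?thesis .
qed

text \<open>The constant does not depend on h, so all polygons are equicontinuous at once.\<close>

lemma euler_polygon_Lipschitz:
  fixes g :: "'a::euclidean_space \<Rightarrow> 'a"
  assumes h: "h > 0" and M: "\<And>z. norm (g z) \<le> M" and st: "0 \<le> s" "0 \<le> t"
  shows "norm (euler_polygon g x h t - euler_polygon g x h s) \<le> M * \<bar>t - s\<bar>"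
proof -
  have *: "norm (euler_polygon g x h t - euler_polygon g x h s) \<le> M * (t - s)" if "0 \<le> s" "s \<le> t" for s t
  proof -
    let ?f = "\<lambda>s. g (euler_step g x h s)"
    have int: "?f integrable_on {0..t}" "integral {0..t} ?f = euler_polygon g x h t - x"
      "integral {0..s} ?f = euler_polygon g x h s - x"
      using euler_has_integral[OF h, of t g x] euler_has_integral[OF h, of s g x] that
      by (auto simp: integral_unique intro: has_integral_integrable)
    have "integral {s..t} ?f = euler_polygon g x h t - euler_polygon g x h s"
      using Henstock_Kurzweil_Integration.integral_combine[OF that int(1)] int by (simp add: algebra_simps)
    moreover have "?f integrable_on {s..t}"
      by (rule integrable_subinterval_real[OF int(1)]) (use that in auto)
    ultimately have "(?f has_integral (euler_polygon g x h t - euler_polygon g x h s)) (cbox s t)"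
      by (metis box_real(2) integrable_integral)
    then have "norm (euler_polygon g x h t - euler_polygon g x h s) \<le> M * measure lborel (cbox s t)"
      using M order_trans[OF norm_ge_zero M[of 0]] by (intro has_integral_bound) auto
    then show ?thesis
      using that by simp
  qed
  show ?thesis
    using *[of s t] *[of t s] st by (cases "s \<le> t") (auto simp: norm_minus_commute)
qed

text \<open>A diagonal sequence of Euler polygons converges at the rational times, hence at all
  times by the common Lipschitz constant. Dominated convergence, with majorant M, carries the
  integral equation to the limit.\<close>

theorem peano_global:
  fixes g :: "'a::euclidean_space \<Rightarrow> 'a"
  assumes g: "continuous_on UNIV g" and M: "\<And>z. norm (g z) \<le> M"
  obtains y where "y 0 = x" "\<And>t. t \<ge> 0 \<Longrightarrow> (y has_vector_derivative g (y t)) (at t within {0..})"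
proof -
  define h where "h n = 1 / real (Suc n)" for n
  have h: "h n > 0" for n
    by (simp add: h_def)
  have h0: "h \<longlonglongrightarrow> 0"
    unfolding h_def by (rule LIMSEQ_inverse_real_of_nat[unfolded inverse_eq_divide])
  define Y where "Y n = euler_polygon g x (h n)" for n
  have Lip: "norm (Y n t - Y n s) \<le> M * \<bar>t - s\<bar>" if "0 \<le> s" "0 \<le> t" for n s t
    unfolding Y_def by (rule euler_polygon_Lipschitz[OF h M that])
  have Mpos: "M \<ge> 0"
    using order_trans[OF norm_ge_zero M[of 0]] .
  have Y0: "Y n 0 = x" for n
    by (simp add: Y_def euler_polygon_def euler_step_def)
  \<comment> \<open>The weight \<open>1 / (1 + q)\<close> makes the bound uniform in \<open>q\<close>, so that one diagonal sequence serves
    the whole half line.\<close>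
  have bounded: "norm ((1 / (1 + q)) *\<^sub>R Y n q) \<le> norm x + M" if "q \<in> \<rat> \<inter> {0..}" for n q
  proof -
    have "norm (Y n q) \<le> norm x + M * q"
      using Lip[of 0 q n] norm_triangle_sub[of "Y n q" x] that by (simp add: Y0)
    also have "\<dots> \<le> (1 + q) * (norm x + M)"
      using that Mpos by (simp add: algebra_simps)
    finally show ?thesis
      using that by (simp add: divide_le_eq mult.commute)
  qed
  have "countable (\<rat> \<inter> {0..} :: real set)"
    using countable_rat by blast
  then have "\<exists>k. strict_mono k \<and> (\<forall>q\<in>\<rat> \<inter> {0..}. \<exists>l. (\<lambda>n. (1 / (1 + q)) *\<^sub>R Y (k n) q) \<longlonglongrightarrow> l)"
    using bounded
    by (rule function_convergent_subsequence[where f = "\<lambda>n q. (1 / (1 + q)) *\<^sub>R Y n q"]) blast+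
  then obtain k where k: "strict_mono k"
    and lim: "\<forall>q\<in>\<rat> \<inter> {0..}. \<exists>l. (\<lambda>n. (1 / (1 + q)) *\<^sub>R Y (k n) q) \<longlonglongrightarrow> l"
    by (elim exE conjE)
  have rat: "\<exists>l. (\<lambda>n. Y (k n) q) \<longlonglongrightarrow> l" if "q \<in> \<rat>" "q \<ge> 0" for q
  proof -
    have "q \<in> \<rat> \<inter> {0..}"
      using that by simp
    then obtain l where "(\<lambda>n. (1 / (1 + q)) *\<^sub>R Y (k n) q) \<longlonglongrightarrow> l"
      using lim by blast
    then have "(\<lambda>n. (1 + q) *\<^sub>R ((1 / (1 + q)) *\<^sub>R Y (k n) q)) \<longlonglongrightarrow> (1 + q) *\<^sub>R l"
      by (intro tendsto_intros)
    then show ?thesis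
      using that by auto
  qed
  have "\<exists>l. (\<lambda>n. Y (k n) t) \<longlonglongrightarrow> l" if t: "t \<ge> 0" for t
  proof -
    have "Cauchy (\<lambda>n. Y (k n) t)"
    proof (rule metric_CauchyI)
      fix e :: real assume "e > 0"
      \<comment> \<open>M + 1 keeps the divisor positive when M = 0.\<close>
      define d where "d = e / (3 * (M + 1))"
      have d: "d > 0" "M * d < e / 3"
        using \<open>e > 0\<close> Mpos by (auto simp: d_def field_simps)
      obtain q where q: "q \<in> \<rat>" "t < q" "q < t + d"
        using Rats_dense_in_real[of t "t + d"] d by auto
      have "Cauchy (\<lambda>n. Y (k n) q)"
        using rat[of q] q t by (auto intro: LIMSEQ_imp_Cauchy)
      then obtain N where N: "\<And>m n. m \<ge> N \<Longrightarrow> n \<ge> N \<Longrightarrow> dist (Y (k m) q) (Y (k n) q) < e / 3"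
        using \<open>e > 0\<close> metric_CauchyD[of "\<lambda>n. Y (k n) q" "e/3"] by auto
      have close: "dist (Y n t) (Y n q) < e / 3" for n
      proof -
        have "dist (Y n t) (Y n q) \<le> M * \<bar>t - q\<bar>"
          using Lip[of q t n] q t by (simp add: dist_norm)
        also have "\<dots> \<le> M * d"
          using q Mpos by (intro mult_left_mono) auto
        finally show ?thesis
          using d by simp
      qed
      have "dist (Y (k m) t) (Y (k n) t) < e" if "m \<ge> N" "n \<ge> N" for m n
        using N[OF that] close[of "k m"] close[of "k n"]
          dist_triangle[of "Y (k m) t" "Y (k n) t" "Y (k m) q"]
          dist_triangle[of "Y (k m) q" "Y (k n) t" "Y (k n) q"]
        by (simp add: dist_commute)
      then show "\<exists>N. \<forall>m\<ge>N. \<forall>n\<ge>N. dist (Y (k m) t) (Y (k n) t) < e"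
        by blast
    qed
    then show ?thesis
      using Cauchy_convergent_iff convergent_def by blast
  qed
  then obtain y where y: "\<And>t. t \<ge> 0 \<Longrightarrow> (\<lambda>n. Y (k n) t) \<longlonglongrightarrow> y t"
    by metis
  have y0: "y 0 = x"
    using y[of 0] Y0 LIMSEQ_unique tendsto_const by fastforce
  have ylip: "norm (y t - y s) \<le> M * \<bar>t - s\<bar>" if "0 \<le> s" "0 \<le> t" for s t
    by (rule LIMSEQ_le_const2[OF tendsto_norm[OF tendsto_diff[OF y y]]]) (use Lip that in auto)
  have ycont: "continuous_on {0..} y"
  proof (rule lipschitz_on_continuous_on)
    show "M-lipschitz_on {0..} y"
      using ylip Mpos by (intro lipschitz_onI) (auto simp: dist_norm)
  qed
  have gcont: "continuous_on {0..} (\<lambda>t. g (y t))"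
    using continuous_on_compose2[OF g ycont] by auto
  have hk0: "(\<lambda>n. h (k n)) \<longlonglongrightarrow> 0"
    using LIMSEQ_subseq_LIMSEQ[OF h0 k] by (simp add: o_def)
  have step: "(\<lambda>n. euler_step g x (h (k n)) s) \<longlonglongrightarrow> y s" if "s \<ge> 0" for s
  proof -
    have "(\<lambda>n. euler_step g x (h (k n)) s - Y (k n) s) \<longlonglongrightarrow> 0"
    proof (rule Lim_null_comparison)
      show "(\<lambda>n. h (k n) * M) \<longlonglongrightarrow> 0"
        using tendsto_mult_left_zero[OF hk0] .
      show "\<forall>\<^sub>F n in sequentially. norm (euler_step g x (h (k n)) s - Y (k n) s) \<le> h (k n) * M"
        using euler_step_polygon_dist[OF h that M] by (simp add: Y_def)
    qed
    from tendsto_add[OF this y[OF that]] show ?thesis by simp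
  qed
  have y_int: "y t = x + integral {0..t} (\<lambda>s. g (y s))" if t: "t \<ge> 0" for t
  proof -
    let ?f = "\<lambda>n s. g (euler_step g x (h (k n)) s)"
    have "(\<lambda>n. integral {0..t} (?f n)) \<longlonglongrightarrow> integral {0..t} (\<lambda>s. g (y s))"
    proof (rule dominated_convergence(2))
      show "?f n integrable_on {0..t}" for n
        using euler_has_integral[OF h t] by blast
      show "(\<lambda>_. M) integrable_on {0..t}"
        by (rule integrable_const_ivl)
      show "norm (?f n s) \<le> M" for n s
        by (rule M)
      show "(\<lambda>n. ?f n s) \<longlonglongrightarrow> g (y s)" if "s \<in> {0..t}" for s
        using step[of s] g that by (intro continuous_on_tendsto_compose[OF g]) auto
    qed
    moreover have "integral {0..t} (?f n) = Y (k n) t - x" for n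
      unfolding Y_def by (rule integral_unique[OF euler_has_integral[OF h t]])
    moreover have "(\<lambda>n. Y (k n) t - x) \<longlonglongrightarrow> y t - x"
      by (intro tendsto_intros y t)
    ultimately show ?thesis
      using LIMSEQ_unique by fastforce
  qed
  have "(y has_vector_derivative g (y t)) (at t within {0..})" if t: "t \<ge> 0" for t
  proof -
    \<comment> \<open>The interval extends beyond t so that the derivative within it agrees with the
      one within the half line.\<close>
    have "((\<lambda>u. integral {0..u} (\<lambda>s. g (y s))) has_vector_derivative g (y t)) (at t within {0..t+1})"
      using t by (intro integral_has_vector_derivative continuous_on_subset[OF gcont]) auto
    then have "((\<lambda>u. x + integral {0..u} (\<lambda>s. g (y s))) has_vector_derivative 0 + g (y t)) (at t within {0..t+1})"
      by (intro has_vector_derivative_add has_vector_derivative_const)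
    then have "(y has_vector_derivative g (y t)) (at t within {0..t+1})"
      by (rule has_vector_derivative_transform[rotated -1, THEN has_vector_derivative_eq_rhs])
         (use t y_int in auto)
    moreover have "at t within {0..t+1} = at t within {0..}"
      by (rule at_within_nhd[of t "{..<t+1}"]) auto
    ultimately show ?thesis by simp
  qed
  then show ?thesis
    using that y0 by blast
qed

section \<open>Matrices, gradients and the Hamiltonian\<close>

text \<open>The norm of a matrix is here the Euclidean norm of its entries, so Cauchy-Schwarz
  applies row by row.\<close>

lemma norm_matrix_vector_mult:
  fixes M :: "real^'n^'m"
  shows "norm (M *v x) \<le> norm M * norm x"
proof -
  have "norm (M *v x) = L2_set (\<lambda>i. norm ((M *v x) $ i)) UNIV"
    by (simp add: norm_vec_def)
  also have "\<dots> \<le> L2_set (\<lambda>i. norm (M $ i) * norm x) UNIV"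
    by (intro L2_set_mono) (auto simp: matrix_vector_mul_component Cauchy_Schwarz_ineq2)
  also have "\<dots> = norm M * norm x"
    by (simp add: L2_set_left_distrib norm_vec_def)
  finally show ?thesis .
qed

lemma bounded_bilinear_matrix_vector_mult:
  "bounded_bilinear ((*v) :: real^'n^'m \<Rightarrow> real^'n \<Rightarrow> real^'m)"
proof
  show "\<exists>K. \<forall>(M::real^'n^'m) x. norm (M *v x) \<le> norm M * norm x * K"
    using norm_matrix_vector_mult by (intro exI[of _ 1]) auto
qed (simp_all add: matrix_vector_mult_add_rdistrib matrix_vector_right_distrib
      scaleR_matrix_vector_assoc matrix_vector_mult_scaleR)

lemmas continuous_on_matrix_vector_mult [continuous_intros] =
  bounded_bilinear.continuous_on[OF bounded_bilinear_matrix_vector_mult]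

lemma continuous_on_transpose [continuous_intros]:
  fixes M :: "'a::topological_space \<Rightarrow> real^'n^'m"
  assumes "continuous_on S M"
  shows "continuous_on S (\<lambda>x. transpose (M x))"
  unfolding transpose_def by (intro continuous_intros assms)

lemma inner_matrix_vector_adjoint:
  fixes M :: "real^'n^'m"
  shows "x \<bullet> (M *v y) = (transpose M *v x) \<bullet> y"
  by (simp add: dot_lmul_matrix)

lemma inner_symmetric_matrix:
  fixes M :: "real^'n^'n"
  assumes "transpose M = M"
  shows "x \<bullet> (M *v y) = (M *v x) \<bullet> y"
  using inner_matrix_vector_adjoint[of x M y] assms by simp

lemma posdef_invertible:
  assumes "posdef R"
  shows "R ** matrix_inv R = mat 1" "R *v (matrix_inv R *v x) = x"
proof -
  have "x = 0" if "R *v x = 0" for x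
    using assms that by (force simp: posdef_def)
  then have "\<exists>L. L ** R = mat 1"
    by (simp add: matrix_left_invertible_ker)
  then have "invertible R"
    by (meson invertible_left_inverse)
  then show "R ** matrix_inv R = mat 1"
    unfolding invertible_def matrix_inv_def by (rule someI2_ex) simp
  then show "R *v (matrix_inv R *v x) = x"
    by (simp add: matrix_vector_mul_assoc)
qed

text \<open>The constant is the minimum of the form on the unit sphere, extended by
  homogeneity.\<close>

lemma posdef_coercive:
  fixes R :: "real^'n^'n"
  assumes "posdef R"
  obtains r where "r > 0" "\<And>u. r * (norm u)\<^sup>2 \<le> u \<bullet> (R *v u)"
proof -
  have "continuous_on (sphere 0 1) (\<lambda>u. u \<bullet> (R *v u))"
    by (intro continuous_intros)
  moreover have "sphere 0 1 \<noteq> ({} :: (real^'n) set)"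
    by simp
  ultimately obtain z :: "real^'n" where z: "z \<in> sphere 0 1"
    "\<And>u. u \<in> sphere 0 1 \<Longrightarrow> z \<bullet> (R *v z) \<le> u \<bullet> (R *v u)"
    using continuous_attains_inf[of "sphere 0 1"] compact_sphere by blast
  have "z \<bullet> (R *v z) * (norm u)\<^sup>2 \<le> u \<bullet> (R *v u)" for u
  proof (cases "u = 0")
    case False
    have "z \<bullet> (R *v z) \<le> (u /\<^sub>R norm u) \<bullet> (R *v (u /\<^sub>R norm u))"
      using False by (intro z) simp
    also have "\<dots> = u \<bullet> (R *v u) / (norm u)\<^sup>2"
      by (simp add: matrix_vector_mult_scaleR power2_eq_square divide_inverse mult_ac)
    finally show ?thesis
      using False by (simp add: field_simps)
  qed simp
  moreover have "z \<bullet> (R *v z) > 0"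
    using assms z(1) unfolding posdef_def by (metis norm_zero dist_0_norm mem_sphere zero_neq_one)
  ultimately show ?thesis
    using that by blast
qed

lemma grad_eqI:
  assumes "GDERIV g x :> v"
  shows "grad g x = v"
  unfolding grad_def
proof (rule the_equality[where a = v])
  fix w assume "GDERIV g x :> w"
  then have "(\<lambda>h. h \<bullet> w) = (\<lambda>h. h \<bullet> v)"
    using has_derivative_unique assms unfolding gderiv_def by blast
  then show "w = v"
    by (metis vector_eq_ldot)
qed (rule assms)

text \<open>The gradient is written as the sum of the values of the derivative on the basis vectors;
  in this form its continuity follows from that of the derivative.\<close>

lemma C1_on_grad:
  assumes "C1_on S g"
  shows "\<And>x. x \<in> S \<Longrightarrow> GDERIV g x :> grad g x" "continuous_on S (grad g)"
proof -
  obtain g' where g': "\<And>x. x \<in> S \<Longrightarrow> (g has_derivative blinfun_apply (g' x)) (at x)"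
    and cont: "continuous_on S g'"
    using assms by (auto simp: C1_on_def)
  have *: "GDERIV g x :> (\<Sum>i\<in>Basis. blinfun_apply (g' x) i *\<^sub>R i)" if "x \<in> S" for x
  proof -
    have "blinfun_apply (g' x) h = h \<bullet> (\<Sum>i\<in>Basis. blinfun_apply (g' x) i *\<^sub>R i)" for h
    proof -
      have "blinfun_apply (g' x) h = blinfun_apply (g' x) (\<Sum>i\<in>Basis. (h \<bullet> i) *\<^sub>R i)"
        by (simp add: euclidean_representation)
      also have "\<dots> = h \<bullet> (\<Sum>i\<in>Basis. blinfun_apply (g' x) i *\<^sub>R i)"
        by (simp add: blinfun.sum_right blinfun.scaleR_right inner_sum_right mult.commute)
      finally show ?thesis .
    qed
    then show ?thesis
      unfolding gderiv_def by (intro has_derivative_eq_rhs[OF g'[OF that]] ext)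
  qed
  then show "GDERIV g x :> grad g x" if "x \<in> S" for x
    using that grad_eqI by metis
  have "continuous_on S (\<lambda>x. \<Sum>i\<in>Basis. blinfun_apply (g' x) i *\<^sub>R i)"
    by (intro continuous_intros cont)
  then show "continuous_on S (grad g)"
    using grad_eqI[OF *] by (simp cong: continuous_on_cong)
qed

lemma C1_on_imp_continuous_on:
  assumes "C1_on S g"
  shows "continuous_on S g"
  using assms unfolding C1_on_def
  by (meson continuous_at_imp_continuous_on has_derivative_continuous)

lemma pderivative_C1:
  assumes "C1_on S P"
  shows "\<exists>P'. continuous_on S P' \<and> (\<forall>x\<in>S. (P has_derivative blinfun_apply (P' x)) (at x) \<and>
    (\<forall>i. pderivative P i x = blinfun_apply (P' x) (axis i 1)))"
proof -
  obtain P' where P': "\<forall>x\<in>S. (P has_derivative blinfun_apply (P' x)) (at x)" "continuous_on S P'"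
    using assms by (auto simp: C1_on_def)
  moreover have "pderivative P i x = blinfun_apply (P' x) (axis i 1)" if "x \<in> S" for x i
    using frechet_derivative_at[OF P'(1)[rule_format, OF that]] by (simp add: pderivative_def)
  ultimately show ?thesis
    by blast
qed

lemma continuous_on_pderivative:
  assumes "C1_on S P"
  shows "continuous_on S (pderivative P i)"
proof -
  obtain P' where P': "continuous_on S P'" "\<forall>x\<in>S. (P has_derivative blinfun_apply (P' x)) (at x) \<and>
    (\<forall>i. pderivative P i x = blinfun_apply (P' x) (axis i 1))"
    using pderivative_C1[OF assms] by (elim exE conjE)
  then have "continuous_on S (\<lambda>x. blinfun_apply (P' x) (axis i 1))"
    by (intro continuous_intros)
  then show ?thesis
    using P'(2) by (simp cong: continuous_on_cong)
qed

lemma continuous_on_phi: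
  assumes "C1_on S P"
  shows "continuous_on S (phi P)"
  unfolding phi_def by (intro continuous_intros continuous_on_pderivative assms)

text \<open>Symmetry of P x makes the two terms that differentiate the outer factors equal, whence
  the 2. The term that differentiates P, expanded in partial derivatives, is
  \<open>phi\<close>.\<close>

lemma GDERIV_sdre_value:
  assumes P: "C1_on S P" and x: "x \<in> S" and sym: "transpose (P x) = P x"
  shows "GDERIV (sdre_value P) x :> 2 *\<^sub>R (P x *v x) + phi P x"
proof -
  obtain P' where C1: "\<forall>x\<in>S. (P has_derivative blinfun_apply (P' x)) (at x) \<and>
    (\<forall>i. pderivative P i x = blinfun_apply (P' x) (axis i 1))"
    using pderivative_C1[OF P] by (elim exE conjE)
  then have P': "(P has_derivative blinfun_apply (P' x)) (at x)"
    and pd: "pderivative P i x = blinfun_apply (P' x) (axis i 1)" for i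
    using x by auto
  have "((\<lambda>z. z \<bullet> (P z *v z)) has_derivative
      (\<lambda>h. x \<bullet> (P x *v h + blinfun_apply (P' x) h *v x) + h \<bullet> (P x *v x))) (at x)"
    by (intro has_derivative_inner has_derivative_ident P'
          bounded_bilinear.FDERIV[OF bounded_bilinear_matrix_vector_mult])
  moreover have "x \<bullet> (P x *v h + blinfun_apply (P' x) h *v x) + h \<bullet> (P x *v x)
      = h \<bullet> (2 *\<^sub>R (P x *v x) + phi P x)" for h
  proof -
    have "blinfun_apply (P' x) h = blinfun_apply (P' x) (\<Sum>i\<in>UNIV. (h $ i) *\<^sub>R axis i 1)"
      using basis_expansion[of h] by (simp add: scalar_mult_eq_scaleR)
    also have "\<dots> = (\<Sum>i\<in>UNIV. (h $ i) *\<^sub>R pderivative P i x)"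
      by (simp add: blinfun.sum_right blinfun.scaleR_right pd)
    finally have "x \<bullet> (blinfun_apply (P' x) h *v x) = (\<Sum>i\<in>UNIV. h $ i * (x \<bullet> (pderivative P i x *v x)))"
      by (simp add: bounded_bilinear.sum_left[OF bounded_bilinear_matrix_vector_mult]
          bounded_bilinear.scaleR_left[OF bounded_bilinear_matrix_vector_mult] inner_sum_right)
    also have "\<dots> = h \<bullet> phi P x"
      by (simp add: phi_def inner_vec_def)
    finally show ?thesis
      using inner_symmetric_matrix[OF sym, of x h] by (simp add: inner_add_right inner_commute)
  qed
  ultimately show ?thesis
    by (simp add: gderiv_def sdre_value_def[abs_def])
qed

definition running_cost :: "real^'d^'d \<Rightarrow> real^'m^'m \<Rightarrow> real^'d \<Rightarrow> real^'m \<Rightarrow> real" where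
  "running_cost Q R y u = y \<bullet> (Q *v y) + u \<bullet> (R *v u)"

lemma running_cost_nonneg:
  assumes "psd Q" "posdef R"
  shows "0 \<le> running_cost Q R y u"
  using assms unfolding running_cost_def psd_def posdef_def
  by (cases "u = 0") (auto intro: add_nonneg_nonneg less_imp_le)

text \<open>Completing the square in the control: the Hamiltonian at \<open>p = 2 X x + \<phi>\<close> is
  minimised by the feedback, and the Riccati equation turns its minimum into the residual.\<close>

lemma hamiltonian_residual:
  fixes A X Q :: "real^'d^'d" and B :: "real^'m^'d" and x \<phi> :: "real^'d"
  assumes R: "posdef R" and X: "transpose X = X" and ric: "riccati A B Q R X = 0"
  defines "p \<equiv> 2 *\<^sub>R (X *v x) + \<phi>"
  defines "v \<equiv> - (1/2) *\<^sub>R (matrix_inv R *v (transpose B *v p))"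
  shows "p \<bullet> (A *v x + B *v u) + running_cost Q R x u =
    \<phi> \<bullet> ((A - B ** matrix_inv R ** transpose B ** X) *v x
         - (1/4) *\<^sub>R ((B ** matrix_inv R ** transpose B) *v \<phi>))
    + (u - v) \<bullet> (R *v (u - v))"
proof -
  have symR: "transpose R = R"
    using R by (simp add: posdef_def)
  define S where "S z = B *v (matrix_inv R *v (transpose B *v z))" for z
  have S_lin: "S (a + b) = S a + S b" "S (c *\<^sub>R a) = c *\<^sub>R S a" for a b c
    by (simp_all add: S_def matrix_vector_right_distrib matrix_vector_mult_scaleR)
  \<comment> \<open>Inserting \<open>R\<close> times its inverse exhibits the form of S as an
    \<open>R\<close>-form of two vectors, so that its symmetry follows from that of
    \<open>R\<close>.\<close>
  have S_form: "a \<bullet> S b = (R *v (matrix_inv R *v (transpose B *v a))) \<bullet> (matrix_inv R *v (transpose B *v b))" for a b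
    unfolding S_def inner_matrix_vector_adjoint posdef_invertible[OF R] ..
  have S_sym: "a \<bullet> S b = b \<bullet> S a" for a b
    unfolding S_form by (metis inner_commute inner_symmetric_matrix[OF symR])
  \<comment> \<open>Stationarity of the Hamiltonian in the control: its derivative B^T p + 2 R u
    vanishes at u = v.\<close>
  have q: "transpose B *v p = - 2 *\<^sub>R (R *v v)"
    unfolding v_def matrix_vector_mult_scaleR posdef_invertible(2)[OF R] by simp
  have pBu: "p \<bullet> (B *v u) = - 2 * (u \<bullet> (R *v v))"
    using inner_matrix_vector_adjoint[of p B u] inner_commute[of u "R *v v"]
    unfolding q by (simp del: transpose_matrix_vector)
  have "v \<bullet> (R *v v) = 1/4 * (p \<bullet> S p)"
    unfolding S_form v_def matrix_vector_mult_scaleR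
    using inner_commute[of "R *v (matrix_inv R *v (transpose B *v p))"] by simp
  also have "\<dots> = (X *v x) \<bullet> S (X *v x) + \<phi> \<bullet> S (X *v x) + 1/4 * (\<phi> \<bullet> S \<phi>)"
    using S_sym[of "X *v x" \<phi>] by (simp add: p_def S_lin inner_add_left inner_add_right)
  finally have vRv: "v \<bullet> (R *v v) = (X *v x) \<bullet> S (X *v x) + \<phi> \<bullet> S (X *v x) + 1/4 * (\<phi> \<bullet> S \<phi>)" .
  \<comment> \<open>The Riccati equation tested with x on both sides.\<close>
  have ric': "2 * ((X *v x) \<bullet> (A *v x)) - (X *v x) \<bullet> S (X *v x) + x \<bullet> (Q *v x) = 0"
  proof -
    have "riccati A B Q R X *v x = transpose A *v (X *v x) + X *v (A *v x) - X *v S (X *v x) + Q *v x"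
      unfolding riccati_def S_def matrix_vector_mult_add_rdistrib matrix_vector_mult_diff_rdistrib
        matrix_vector_mul_assoc matrix_mul_assoc ..
    moreover have "x \<bullet> (transpose A *v (X *v x)) = (X *v x) \<bullet> (A *v x)"
      using inner_matrix_vector_adjoint[of "X *v x" A x] by (simp only: inner_commute)
    ultimately show ?thesis
      using arg_cong[OF ric, of "\<lambda>M. x \<bullet> (M *v x)"] inner_symmetric_matrix[OF X, of x "A *v x"]
        inner_symmetric_matrix[OF X, of x "S (X *v x)"]
      by (simp only: inner_add_right inner_diff_right matrix_vector_mult_0 inner_zero_right)
  qed
  have sq: "(u - v) \<bullet> (R *v (u - v)) = u \<bullet> (R *v u) - 2 * (u \<bullet> (R *v v)) + v \<bullet> (R *v v)"
    using inner_symmetric_matrix[OF symR, of v u] inner_commute[of "R *v v" u]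
    by (simp add: matrix_vector_mult_diff_distrib inner_diff_left inner_diff_right)
  have "p \<bullet> (A *v x) = 2 * ((X *v x) \<bullet> (A *v x)) + \<phi> \<bullet> (A *v x)"
    by (simp add: p_def inner_add_left)
  moreover have "\<phi> \<bullet> ((A - B ** matrix_inv R ** transpose B ** X) *v x
         - (1/4) *\<^sub>R ((B ** matrix_inv R ** transpose B) *v \<phi>))
     = \<phi> \<bullet> (A *v x) - \<phi> \<bullet> S (X *v x) - 1/4 * (\<phi> \<bullet> S \<phi>)"
    unfolding S_def matrix_vector_mult_diff_rdistrib inner_diff_right matrix_vector_mul_assoc matrix_mul_assoc
    by (simp only: inner_scaleR_right)
  ultimately show ?thesis
    unfolding running_cost_def inner_add_right using sq vRv ric' pBu by linarith
qed

section \<open>Integrals over the half line\<close>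

lemma set_nn_integral_Icc:
  fixes h :: "real \<Rightarrow> real"
  assumes "continuous_on {0..T} h" "\<And>t. t \<in> {0..T} \<Longrightarrow> 0 \<le> h t"
  shows "(\<integral>\<^sup>+t\<in>{0..T}. ennreal (h t) \<partial>lebesgue) = ennreal (integral {0..T} h)"
proof -
  have "(h has_integral integral {0..T} h) {0..T}"
    using assms(1) by (intro integrable_integral integrable_continuous_interval)
  from nn_integral_has_integral_lebesgue[OF assms(2) this]
  show ?thesis
    unfolding nn_integral_completion
    by (auto intro!: nn_integral_cong elim!: trans[rotated] simp: indicator_def)
qed

lemma set_nn_integral_atLeast_ge:
  fixes h :: "real \<Rightarrow> real"
  assumes "continuous_on {0..} h" "\<And>t. t \<ge> 0 \<Longrightarrow> 0 \<le> h t"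
  shows "ennreal (integral {0..T} h) \<le> (\<integral>\<^sup>+t\<in>{0..}. ennreal (h t) \<partial>lebesgue)"
proof -
  have "ennreal (integral {0..T} h) = (\<integral>\<^sup>+t\<in>{0..T}. ennreal (h t) \<partial>lebesgue)"
    using assms by (intro set_nn_integral_Icc[symmetric]) (auto intro: continuous_on_subset)
  also have "\<dots> \<le> (\<integral>\<^sup>+t\<in>{0..}. ennreal (h t) \<partial>lebesgue)"
    by (intro nn_integral_mono) (auto simp: indicator_def)
  finally show ?thesis .
qed

text \<open>Monotone convergence along the intervals [0,n]; the bound \<open>C\<close> may be
  infinite.\<close>

lemma set_nn_integral_atLeast_le:
  fixes h :: "real \<Rightarrow> real"
  assumes h: "continuous_on {0..} h" "\<And>t. t \<ge> 0 \<Longrightarrow> 0 \<le> h t"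
    and le: "\<And>T. T \<ge> 0 \<Longrightarrow> ennreal (integral {0..T} h) \<le> C"
  shows "(\<integral>\<^sup>+t\<in>{0..}. ennreal (h t) \<partial>lebesgue) \<le> C"
proof -
  let ?g = "\<lambda>(n::nat) t. ennreal (h t) * indicator {0..real n} t"
  have "ennreal (h t) * indicator {0..} t = (SUP n. ?g n t)" for t
  proof (rule antisym)
    obtain n :: nat where "t \<le> real n"
      using real_arch_simple by blast
    then have "ennreal (h t) * indicator {0..} t \<le> ?g n t"
      by (auto simp: indicator_def)
    then show "ennreal (h t) * indicator {0..} t \<le> (SUP n. ?g n t)"
      by (rule SUP_upper2[OF UNIV_I])
    show "(SUP n. ?g n t) \<le> ennreal (h t) * indicator {0..} t"
      by (intro SUP_least) (auto simp: indicator_def)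
  qed
  then have "(\<integral>\<^sup>+t\<in>{0..}. ennreal (h t) \<partial>lebesgue) = (\<integral>\<^sup>+t. (SUP n. ?g n t) \<partial>lborel)"
    by (simp add: nn_integral_completion)
  also have "\<dots> = (SUP n. \<integral>\<^sup>+t. ?g n t \<partial>lborel)"
  proof (rule nn_integral_monotone_convergence_SUP)
    show "incseq ?g"
      by (auto simp: incseq_def le_fun_def indicator_def)
    fix n
    have "continuous_on {0..real n} h"
      using h(1) by (rule continuous_on_subset) auto
    then have "(\<lambda>t. indicator {0..real n} t *\<^sub>R h t) \<in> borel_measurable borel"
      by (intro borel_measurable_continuous_on_indicator) auto
    then have "(\<lambda>t. ennreal (indicator {0..real n} t *\<^sub>R h t)) \<in> borel_measurable lborel"
      by simp
    moreover have "(\<lambda>t. ennreal (indicator {0..real n} t *\<^sub>R h t)) = ?g n"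
      by (auto simp: indicator_def)
    ultimately show "?g n \<in> borel_measurable lborel"
      by simp
  qed
  also have "\<dots> \<le> C"
  proof (rule SUP_least)
    fix n :: nat
    have "(\<integral>\<^sup>+t. ?g n t \<partial>lborel) = (\<integral>\<^sup>+t\<in>{0..real n}. ennreal (h t) \<partial>lebesgue)"
      by (simp add: nn_integral_completion)
    also have "\<dots> = ennreal (integral {0..real n} h)"
      using h by (intro set_nn_integral_Icc) (auto intro: continuous_on_subset)
    finally show "(\<integral>\<^sup>+t. ?g n t \<partial>lborel) \<le> C"
      using le[of "real n"] by simp
  qed
  finally show ?thesis .
qed

text \<open>Consider the first time at which the norm reaches \<rho>. Up to and including it the
  norm is at most \<rho>, so \<open>step\<close> applies at that time and contradicts its choice;
  the weak inequality in \<open>step\<close> accounts for this last instant.\<close>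

lemma norm_trapped:
  fixes y :: "real \<Rightarrow> 'a::real_normed_vector"
  assumes y: "continuous_on {0..} y" "norm (y 0) < \<rho>"
    and step: "\<And>T. T \<ge> 0 \<Longrightarrow> (\<And>t. t \<in> {0..T} \<Longrightarrow> norm (y t) \<le> \<rho>) \<Longrightarrow> norm (y T) < \<rho>"
    and t: "t \<ge> 0"
  shows "norm (y t) < \<rho>"
proof (rule ccontr)
  assume "\<not> norm (y t) < \<rho>"
  define X where "X = {s \<in> {0..t}. norm (y s) \<in> {\<rho>..}}"
  have cont: "continuous_on {0..t} (\<lambda>s. norm (y s))"
    using y(1) by (intro continuous_on_norm continuous_on_subset[OF y(1)]) auto
  have "X = {0..t} \<inter> (\<lambda>s. norm (y s)) -` {\<rho>..}"
    by (auto simp: X_def)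
  then have "closed X"
    using continuous_closed_preimage[OF cont closed_real_atLeastAtMost, of "{\<rho>..}"] by simp
  have X: "t \<in> X" "bdd_below X"
    using \<open>\<not> norm (y t) < \<rho>\<close> t by (auto simp: X_def)
  then have Inf: "Inf X \<in> X"
    using \<open>closed X\<close> closed_contains_Inf by blast
  have below: "norm (y s) < \<rho>" if "0 \<le> s" "s < Inf X" for s
    using that cInf_lower[OF _ X(2), of s] Inf by (force simp: X_def)
  have "norm (y (Inf X)) \<le> \<rho>"
  proof (rule ccontr)
    assume "\<not> norm (y (Inf X)) \<le> \<rho>"
    \<comment> \<open>A value above \<rho> at the first time would force an earlier crossing of
      \<rho>.\<close>
    then obtain s where "0 \<le> s" "s \<le> Inf X" "norm (y s) = \<rho>"
      using IVT'[of "\<lambda>s. norm (y s)" 0 \<rho> "Inf X"] y(2) Inf cont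
      by (fastforce simp: X_def intro: continuous_on_subset)
    then show False
      using below[of s] \<open>\<not> norm (y (Inf X)) \<le> \<rho>\<close> by (cases "s = Inf X") auto
  qed
  then have "norm (y s) \<le> \<rho>" if "s \<in> {0..Inf X}" for s
    using below[of s] that by (cases "s = Inf X") auto
  then have "norm (y (Inf X)) < \<rho>"
    using Inf by (intro step) (auto simp: X_def)
  then show False
    using Inf by (simp add: X_def)
qed

section \<open>The Riccati feedback and its residual\<close>

locale sdre =
  fixes f :: "real^'d \<Rightarrow> real^'d" and B :: "real^'d \<Rightarrow> real^'m^'d"
    and A P :: "real^'d \<Rightarrow> real^'d^'d" and Q :: "real^'d^'d" and R :: "real^'m^'m"
    and \<O> :: "(real^'d) set"
  assumes open_O: "open \<O>"
    and cont_f: "continuous_on \<O> f" and cont_B: "continuous_on \<O> B" and cont_A: "continuous_on \<O> A"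
    and fA: "\<And>x. x \<in> \<O> \<Longrightarrow> f x = A x *v x"
    and posdef_R: "posdef R" and psd_Q: "psd Q"
    and psd_P: "\<And>x. x \<in> \<O> \<Longrightarrow> psd (P x)"
    and riccati_P: "\<And>x. x \<in> \<O> \<Longrightarrow> riccati (A x) (B x) Q R (P x) = 0"
    and C1_P: "C1_on \<O> P"
begin

abbreviation "VS \<equiv> sdre_value P"
abbreviation "E \<equiv> residual A B R P"
abbreviation "uS \<equiv> feedback B R VS"
abbreviation "cost_rate \<equiv> running_cost Q R"

text \<open>The control is an arbitrary function of time, so the optimal control and
  \<open>uS\<close> are treated alike. The horizon is finite because estimates are needed before the
  trajectory is known to stay near 0.\<close>

definition solves_on :: "(real \<Rightarrow> real^'d) \<Rightarrow> (real \<Rightarrow> real^'m) \<Rightarrow> real \<Rightarrow> bool" where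
  "solves_on y w T \<longleftrightarrow>
     (\<forall>t\<in>{0..T}. (y has_vector_derivative (f (y t) + B (y t) *v w t)) (at t within {0..T}))"

lemma solves_onI:
  assumes "\<And>t. t \<ge> 0 \<Longrightarrow> (y has_vector_derivative (f (y t) + B (y t) *v w t)) (at t within {0..})"
  shows "solves_on y w T"
  unfolding solves_on_def
  using has_vector_derivative_within_subset[OF assms] by auto

lemma solves_on_continuous: "solves_on y w T \<Longrightarrow> continuous_on {0..T} y"
  unfolding solves_on_def by (rule continuous_on_vector_derivative) blast

lemma symmetric_P: "x \<in> \<O> \<Longrightarrow> transpose (P x) = P x"
  using psd_P by (simp add: psd_def)

lemma VS_nonneg: "x \<in> \<O> \<Longrightarrow> 0 \<le> VS x"
  using psd_P by (simp add: psd_def sdre_value_def)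

lemma GDERIV_VS: "x \<in> \<O> \<Longrightarrow> GDERIV VS x :> 2 *\<^sub>R (P x *v x) + phi P x"
  by (rule GDERIV_sdre_value[OF C1_P _ symmetric_P])

lemma grad_VS: "x \<in> \<O> \<Longrightarrow> grad VS x = 2 *\<^sub>R (P x *v x) + phi P x"
  by (rule grad_eqI[OF GDERIV_VS])

lemma cont_P: "continuous_on \<O> P"
  by (rule C1_on_imp_continuous_on[OF C1_P])

lemma cont_VS: "continuous_on \<O> VS"
  unfolding sdre_value_def[abs_def] by (intro continuous_intros cont_P)

lemma cont_uS: "continuous_on \<O> uS"
proof -
  have "continuous_on \<O> (\<lambda>x. 2 *\<^sub>R (P x *v x) + phi P x)"
    by (intro continuous_intros cont_P continuous_on_phi C1_P)
  then have "continuous_on \<O> (grad VS)"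
    using grad_VS by (simp cong: continuous_on_cong)
  then show ?thesis
    unfolding feedback_def[abs_def]
    by (intro continuous_intros cont_B)
qed

text \<open>Matrix products become successive applications to vectors, for which a continuity rule
  is at hand.\<close>

lemma residual_nested:
  "E x = phi P x \<bullet> (A x *v x - B x *v (matrix_inv R *v (transpose (B x) *v (P x *v x)))
     - (1/4) *\<^sub>R (B x *v (matrix_inv R *v (transpose (B x) *v phi P x))))"
  unfolding residual_def matrix_vector_mult_diff_rdistrib matrix_vector_mul_assoc matrix_mul_assoc ..

lemma cont_drift:
  "continuous_on \<O> (\<lambda>x. A x *v x - B x *v (matrix_inv R *v (transpose (B x) *v (P x *v x)))
     - (1/4) *\<^sub>R (B x *v (matrix_inv R *v (transpose (B x) *v phi P x))))"
  by (intro continuous_intros cont_A cont_B cont_P continuous_on_phi C1_P)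

lemma cont_E: "continuous_on \<O> E"
  unfolding residual_nested by (intro continuous_on_inner cont_drift continuous_on_phi C1_P)

lemma E_0: "E 0 = 0"
  by (simp add: residual_def phi_def inner_vec_def)

lemma hamiltonian_VS:
  assumes "x \<in> \<O>"
  shows "grad VS x \<bullet> (f x + B x *v u) + cost_rate x u = E x + (u - uS x) \<bullet> (R *v (u - uS x))"
  using hamiltonian_residual[OF posdef_R symmetric_P[OF assms] riccati_P[OF assms], of x "phi P x" u]
  by (simp only: fA[OF assms] feedback_def grad_VS[OF assms] residual_def)

lemma cont_cost_rate:
  assumes "continuous_on S y" "continuous_on S w"
  shows "continuous_on S (\<lambda>t. cost_rate (y t) (w t))"
  unfolding running_cost_def by (intro continuous_intros assms)

text \<open>The chain rule for \<open>VS\<close> along y, rewritten by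
  \<open>hamiltonian_VS\<close>. Dropping the square gives \<open>VS_le_cost\<close>; for the
  feedback itself the square vanishes, which gives \<open>feedback_cost\<close>.\<close>

lemma balance:
  assumes "T \<ge> 0" and sol: "solves_on y w T" and O: "\<And>t. t \<in> {0..T} \<Longrightarrow> y t \<in> \<O>"
  shows "((\<lambda>t. E (y t) + (w t - uS (y t)) \<bullet> (R *v (w t - uS (y t))) - cost_rate (y t) (w t))
     has_integral (VS (y T) - VS (y 0))) {0..T}"
proof -
  have "((\<lambda>t. VS (y t)) has_vector_derivative
      (E (y t) + (w t - uS (y t)) \<bullet> (R *v (w t - uS (y t))) - cost_rate (y t) (w t))) (at t within {0..T})"
    if t: "t \<in> {0..T}" for t
  proof -
    have "(VS has_derivative (\<lambda>h. h \<bullet> grad VS (y t))) (at (y t) within y ` {0..T})"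
      using GDERIV_VS[OF O[OF t]] grad_VS[OF O[OF t]]
      by (auto simp: gderiv_def intro: has_derivative_at_withinI)
    moreover have "(y has_vector_derivative (f (y t) + B (y t) *v w t)) (at t within {0..T})"
      using sol t by (auto simp: solves_on_def)
    ultimately have "((VS \<circ> y) has_vector_derivative (f (y t) + B (y t) *v w t) \<bullet> grad VS (y t)) (at t within {0..T})"
      using vector_derivative_diff_chain_within by blast
    moreover have "(f (y t) + B (y t) *v w t) \<bullet> grad VS (y t) =
        E (y t) + (w t - uS (y t)) \<bullet> (R *v (w t - uS (y t))) - cost_rate (y t) (w t)"
      using hamiltonian_VS[OF O[OF t], of "w t"] by (simp add: inner_commute)
    ultimately show ?thesis
      by (simp add: o_def)
  qed
  then show ?thesis
    using fundamental_theorem_of_calculus[OF \<open>T \<ge> 0\<close>] by fastforce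
qed

lemma VS_le_cost:
  assumes "T \<ge> 0" and sol: "solves_on y w T" and O: "\<And>t. t \<in> {0..T} \<Longrightarrow> y t \<in> \<O>"
    and w: "continuous_on {0..T} w"
  shows "VS (y 0) \<le> VS (y T) + integral {0..T} (\<lambda>t. cost_rate (y t) (w t)) - integral {0..T} (\<lambda>t. E (y t))"
proof -
  have y: "continuous_on {0..T} y"
    using sol by (rule solves_on_continuous)
  have "continuous_on {0..T} (\<lambda>t. E (y t))"
    using continuous_on_compose2[OF cont_E y] O by blast
  then have "((\<lambda>t. E (y t) - cost_rate (y t) (w t)) has_integral
      (integral {0..T} (\<lambda>t. E (y t)) - integral {0..T} (\<lambda>t. cost_rate (y t) (w t)))) {0..T}"
    by (intro has_integral_diff integrable_integral integrable_continuous_interval cont_cost_rate y w)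
  moreover have "0 \<le> u \<bullet> (R *v u)" for u
    using posdef_R unfolding posdef_def by (cases "u = 0") (auto intro: less_imp_le)
  ultimately have "integral {0..T} (\<lambda>t. E (y t)) - integral {0..T} (\<lambda>t. cost_rate (y t) (w t)) \<le> VS (y T) - VS (y 0)"
    using balance[OF assms(1-3)] by (elim has_integral_le) auto
  then show ?thesis
    by simp
qed

lemma feedback_cost:
  assumes "T \<ge> 0" and sol: "solves_on y (\<lambda>t. uS (y t)) T" and O: "\<And>t. t \<in> {0..T} \<Longrightarrow> y t \<in> \<O>"
  shows "integral {0..T} (\<lambda>t. cost_rate (y t) (uS (y t))) = VS (y 0) - VS (y T) + integral {0..T} (\<lambda>t. E (y t))"
proof -
  have y: "continuous_on {0..T} y"
    using sol by (rule solves_on_continuous)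
  have "continuous_on {0..T} (\<lambda>t. E (y t))" "continuous_on {0..T} (\<lambda>t. uS (y t))"
    using continuous_on_compose2[OF cont_E y] continuous_on_compose2[OF cont_uS y] O by blast+
  then have "((\<lambda>t. E (y t) - cost_rate (y t) (uS (y t))) has_integral
      (integral {0..T} (\<lambda>t. E (y t)) - integral {0..T} (\<lambda>t. cost_rate (y t) (uS (y t))))) {0..T}"
    by (intro has_integral_diff integrable_integral integrable_continuous_interval cont_cost_rate y)
  from has_integral_unique[OF this] balance[OF assms] show ?thesis
    by fastforce
qed

section \<open>Trapping near the origin\<close>

text \<open>The last two clauses share \<open>c\<close> and \<open>k\<close> on purpose: the decay
  granted by the first is what absorbs the residual in the second.\<close>

definition lyapunov_data :: "(real^'d \<Rightarrow> real^'d) \<Rightarrow> real \<Rightarrow> real \<Rightarrow> real \<Rightarrow> real \<Rightarrow> bool" where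
  "lyapunov_data m a c k \<rho> \<longleftrightarrow> linear m \<and> (\<forall>x y. x \<bullet> m y = m x \<bullet> y) \<and> a > 0 \<and> c > 0 \<and> k > 0 \<and> \<rho> > 0 \<and>
     cball 0 \<rho> \<subseteq> \<O> \<and> (\<forall>x. a * (norm x)\<^sup>2 \<le> x \<bullet> m x) \<and>
     (\<forall>y\<in>cball 0 \<rho>. \<forall>u. 2 * (m y \<bullet> (f y + B y *v u)) \<le> - c * (norm y)\<^sup>2 + k * cost_rate y u) \<and>
     (\<forall>y\<in>cball 0 \<rho>. k * \<bar>E y\<bar> \<le> c * (norm y)\<^sup>2)"

lemma energy_estimate:
  assumes L: "lyapunov_data m a c k \<rho>" and "T \<ge> 0" and sol: "solves_on y w T"
    and y_ball: "\<And>t. t \<in> {0..T} \<Longrightarrow> norm (y t) \<le> \<rho>" and w: "continuous_on {0..T} w"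
  shows "y T \<bullet> m (y T) + c * integral {0..T} (\<lambda>t. (norm (y t))\<^sup>2)
     \<le> y 0 \<bullet> m (y 0) + k * integral {0..T} (\<lambda>t. cost_rate (y t) (w t))"
proof -
  have m: "linear m" "\<And>x y. x \<bullet> m y = m x \<bullet> y"
    and dec: "\<And>y u. norm y \<le> \<rho> \<Longrightarrow> 2 * (m y \<bullet> (f y + B y *v u)) \<le> - c * (norm y)\<^sup>2 + k * cost_rate y u"
    using L by (auto simp: lyapunov_data_def)
  have "((\<lambda>t. y t \<bullet> m (y t)) has_vector_derivative 2 * (m (y t) \<bullet> (f (y t) + B (y t) *v w t))) (at t within {0..T})"
    if t: "t \<in> {0..T}" for t
  proof -
    let ?d = "f (y t) + B (y t) *v w t"
    have d: "(y has_vector_derivative ?d) (at t within {0..T})"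
      using sol t by (auto simp: solves_on_def)
    moreover have "((\<lambda>t. m (y t)) has_vector_derivative m ?d) (at t within {0..T})"
      using bounded_linear.has_vector_derivative[OF linear_conv_bounded_linear[THEN iffD1, OF m(1)] d] .
    ultimately have "((\<lambda>t. y t \<bullet> m (y t)) has_vector_derivative (y t \<bullet> m ?d + ?d \<bullet> m (y t))) (at t within {0..T})"
      by (rule bounded_bilinear.has_vector_derivative[OF bounded_bilinear_inner])
    then show ?thesis
      using m(2)[of "y t" ?d] by (simp add: inner_commute)
  qed
  then have "((\<lambda>t. 2 * (m (y t) \<bullet> (f (y t) + B (y t) *v w t))) has_integral (y T \<bullet> m (y T) - y 0 \<bullet> m (y 0))) {0..T}"
    by (rule fundamental_theorem_of_calculus[OF \<open>T \<ge> 0\<close>])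
  moreover have "((\<lambda>t. - c * (norm (y t))\<^sup>2 + k * cost_rate (y t) (w t)) has_integral
      (- c * integral {0..T} (\<lambda>t. (norm (y t))\<^sup>2) + k * integral {0..T} (\<lambda>t. cost_rate (y t) (w t)))) {0..T}"
    using solves_on_continuous[OF sol] w
    by (intro has_integral_add has_integral_mult_right integrable_integral integrable_continuous_interval
        cont_cost_rate continuous_intros)
  ultimately have "y T \<bullet> m (y T) - y 0 \<bullet> m (y 0)
      \<le> - c * integral {0..T} (\<lambda>t. (norm (y t))\<^sup>2) + k * integral {0..T} (\<lambda>t. cost_rate (y t) (w t))"
    by (rule has_integral_le) (use dec y_ball in auto)
  then show ?thesis
    by simp
qed

text \<open>Here v is a cost bound: the optimal value for the optimal trajectory,
  \<open>VS x\<close> for the feedback. On the sphere of radius \<rho> the form is at least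
  \<open>a * \<rho>\<^sup>2\<close>, which the energy cannot reach.\<close>

lemma trapped:
  fixes y :: "real \<Rightarrow> real^'d"
  assumes L: "lyapunov_data m a c k \<rho>" and y: "continuous_on {0..} y" "norm (y 0) < \<rho>"
    and small: "y 0 \<bullet> m (y 0) + k * v < a * \<rho>\<^sup>2"
    and step: "\<And>T. T \<ge> 0 \<Longrightarrow> (\<And>t. t \<in> {0..T} \<Longrightarrow> norm (y t) \<le> \<rho>) \<Longrightarrow>
       y T \<bullet> m (y T) \<le> y 0 \<bullet> m (y 0) + k * v"
    and "t \<ge> 0"
  shows "norm (y t) < \<rho>"
proof (rule norm_trapped[where y = y and \<rho> = \<rho>])
  show "continuous_on {0..} y" "norm (y 0) < \<rho>" "t \<ge> 0"
    by fact+
  fix T :: real assume T: "T \<ge> 0" "\<And>t. t \<in> {0..T} \<Longrightarrow> norm (y t) \<le> \<rho>"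
  have a: "a > 0" "\<rho> > 0" "a * (norm (y T))\<^sup>2 \<le> y T \<bullet> m (y T)"
    using L by (auto simp: lyapunov_data_def)
  then have "a * (norm (y T))\<^sup>2 < a * \<rho>\<^sup>2"
    using step[OF T] small by linarith
  then have "(norm (y T))\<^sup>2 < \<rho>\<^sup>2"
    using a by simp
  then show "norm (y T) < \<rho>"
    using a(2) power2_less_imp_less[of "norm (y T)" \<rho>] by simp
qed

text \<open>By \<open>feedback_cost\<close> the running cost is \<open>VS (y 0) - VS (y T)\<close>
  plus the integral of \<open>E\<close>, and k times that integral is at most the decay term of
  \<open>energy_estimate\<close>.\<close>

lemma feedback_energy:
  assumes L: "lyapunov_data m a c k \<rho>" and "T \<ge> 0" and sol: "solves_on y (\<lambda>t. uS (y t)) T"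
    and y_ball: "\<And>t. t \<in> {0..T} \<Longrightarrow> norm (y t) \<le> \<rho>"
  shows "y T \<bullet> m (y T) \<le> y 0 \<bullet> m (y 0) + k * VS (y 0)"
proof -
  have k: "k > 0" "c > 0" and ball: "cball 0 \<rho> \<subseteq> \<O>"
    and Eb: "\<And>y. norm y \<le> \<rho> \<Longrightarrow> k * \<bar>E y\<bar> \<le> c * (norm y)\<^sup>2"
    using L by (auto simp: lyapunov_data_def)
  have O: "y t \<in> \<O>" if "t \<in> {0..T}" for t
    using ball y_ball[OF that] by auto
  have y: "continuous_on {0..T} y"
    using sol by (rule solves_on_continuous)
  have cont: "continuous_on {0..T} (\<lambda>t. E (y t))" "continuous_on {0..T} (\<lambda>t. uS (y t))"
    using continuous_on_compose2[OF cont_E y] continuous_on_compose2[OF cont_uS y] O by blast+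
  have "k * integral {0..T} (\<lambda>t. E (y t)) = integral {0..T} (\<lambda>t. k * E (y t))"
    by simp
  also have "\<dots> \<le> integral {0..T} (\<lambda>t. c * (norm (y t))\<^sup>2)"
  proof (rule integral_le)
    show "(\<lambda>t. k * E (y t)) integrable_on {0..T}" "(\<lambda>t. c * (norm (y t))\<^sup>2) integrable_on {0..T}"
      by (intro integrable_continuous_interval continuous_intros cont y)+
    fix t assume "t \<in> {0..T}"
    then have "k * \<bar>E (y t)\<bar> \<le> c * (norm (y t))\<^sup>2"
      by (intro Eb y_ball)
    moreover have "k * E (y t) \<le> k * \<bar>E (y t)\<bar>"
      using k by simp
    ultimately show "k * E (y t) \<le> c * (norm (y t))\<^sup>2"
      by linarith
  qed
  finally have "k * integral {0..T} (\<lambda>t. E (y t)) \<le> c * integral {0..T} (\<lambda>t. (norm (y t))\<^sup>2)"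
    by simp
  moreover have "k * VS (y T) \<ge> 0"
    using k VS_nonneg[OF O[of T]] \<open>T \<ge> 0\<close> by simp
  moreover have "k * integral {0..T} (\<lambda>t. cost_rate (y t) (uS (y t)))
      = k * VS (y 0) - k * VS (y T) + k * integral {0..T} (\<lambda>t. E (y t))"
    using feedback_cost[OF \<open>T \<ge> 0\<close> sol O] by (simp only: right_diff_distrib distrib_left)
  ultimately show ?thesis
    using energy_estimate[OF L \<open>T \<ge> 0\<close> sol y_ball cont(2)] by linarith
qed

text \<open>Composing the field with the projection onto the ball makes it bounded and continuous
  everywhere, as Peano's theorem requires. While the solution is in the ball the projection is the
  identity and \<open>feedback_energy\<close> applies, so the solution never leaves.\<close>

lemma feedback_solution_exists:
  assumes L: "lyapunov_data m a c k \<rho>" and x: "norm x < \<rho>" "x \<bullet> m x + k * VS x < a * \<rho>\<^sup>2"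
  obtains y where "closed_loop_trajectory f B uS \<O> x y"
proof -
  have \<rho>: "\<rho> > 0" and ball: "cball 0 \<rho> \<subseteq> \<O>"
    using L by (auto simp: lyapunov_data_def)
  define g where "g z = f z + B z *v uS z" for z
  define p where "p z = closest_point (cball 0 \<rho>) z" for z :: "real^'d"
  have p: "p z \<in> cball 0 \<rho>" "z \<in> cball 0 \<rho> \<Longrightarrow> p z = z" for z
    unfolding p_def using \<rho> closest_point_in_set[of "cball 0 \<rho>" z] by (auto intro: closest_point_self)
  have g: "continuous_on (cball 0 \<rho>) g"
    unfolding g_def by (intro continuous_intros continuous_on_subset[OF _ ball] cont_f cont_B cont_uS)
  have "continuous_on UNIV p"
    unfolding p_def using \<rho> by (intro continuous_on_closest_point) auto
  then have gp: "continuous_on UNIV (\<lambda>z. g (p z))"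
    using continuous_on_compose2[OF g] p(1) by blast
  have "bounded (g ` cball 0 \<rho>)"
    by (intro compact_imp_bounded compact_continuous_image g) simp
  then obtain M where M: "\<And>z. norm (g (p z)) \<le> M"
    unfolding bounded_iff using p(1) by blast
  obtain y where y0: "y 0 = x" and y: "\<And>t. t \<ge> 0 \<Longrightarrow> (y has_vector_derivative g (p (y t))) (at t within {0..})"
    using peano_global[OF gp M] by blast
  have cont: "continuous_on {0..} y"
    by (rule continuous_on_vector_derivative) (use y in auto)
  have "norm (y t) < \<rho>" if "t \<ge> 0" for t
  proof (rule trapped[OF L cont, where v = "VS x"])
    fix T :: real assume T: "T \<ge> 0" "\<And>t. t \<in> {0..T} \<Longrightarrow> norm (y t) \<le> \<rho>"
    have sol: "solves_on y (\<lambda>t. uS (y t)) T"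
      unfolding solves_on_def
    proof
      fix t assume t: "t \<in> {0..T}"
      then have "(y has_vector_derivative g (p (y t))) (at t within {0..T})"
        using y[of t] by (auto intro: has_vector_derivative_within_subset)
      then show "(y has_vector_derivative (f (y t) + B (y t) *v uS (y t))) (at t within {0..T})"
        using p(2)[of "y t"] T(2)[OF t] by (simp add: g_def)
    qed
    then show "y T \<bullet> m (y T) \<le> y 0 \<bullet> m (y 0) + k * VS x"
      using feedback_energy[OF L T(1) sol T(2)] y0 by simp
  qed (use x y0 that in auto)
  then have in_ball: "y t \<in> cball 0 \<rho>" if "t \<ge> 0" for t
    using that by (simp add: less_imp_le)
  have "closed_loop_trajectory f B uS \<O> x y"
    unfolding closed_loop_trajectory_def
    using y0 in_ball ball y p(2) by (auto simp: g_def)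
  then show ?thesis
    using that by blast
qed

end

section \<open>Elementary estimates near a point and under exponential decay\<close>

lemma eventually_near_of_continuous_on:
  fixes g :: "'a::t2_space \<Rightarrow> 'b::metric_space"
  assumes "continuous_on S g" "open S" "x \<in> S" "e > 0"
  shows "\<forall>\<^sub>F y in nhds x. dist (g y) (g x) < e"
proof -
  have "isCont g x"
    using assms by (simp add: continuous_on_eq_continuous_at)
  then have "(g \<longlongrightarrow> g x) (nhds x)"
    by (simp add: isCont_def tendsto_at_iff_tendsto_nhds)
  then show ?thesis
    using \<open>e > 0\<close> by (rule tendstoD)
qed

lemma eventually_less_of_continuous_on:
  fixes g :: "'a::t2_space \<Rightarrow> real"
  assumes "continuous_on S g" "open S" "x \<in> S" "g x < b"
  shows "\<forall>\<^sub>F y in nhds x. g y < b"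
  using eventually_near_of_continuous_on[OF assms(1-3), of "b - g x"] assms(4)
  by (auto elim!: eventually_mono simp: dist_real_def)

lemma young_inequality:
  fixes c :: real
  assumes "c > 0"
  shows "2 * p * s * t \<le> c/4 * s\<^sup>2 + 4 * p\<^sup>2 / c * t\<^sup>2"
proof -
  have "0 \<le> (c/2 * s - 2 * p * t)\<^sup>2 / c"
    using assms by simp
  also have "\<dots> = c/4 * s\<^sup>2 + 4 * p\<^sup>2 / c * t\<^sup>2 - 2 * p * s * t"
    using assms by (simp add: power2_eq_square field_simps)
  finally show ?thesis by simp
qed

text \<open>The time K / (lam \<epsilon>) suffices because exp s > s.\<close>

lemma exp_decay_less:
  fixes lam :: real
  assumes "lam > 0" "\<epsilon> > 0" "K \<ge> 0"
  obtains T where "T \<ge> 0" "\<And>t. t \<ge> T \<Longrightarrow> K * exp (- lam * t) < \<epsilon>"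
proof
  show "K / (lam * \<epsilon>) \<ge> 0"
    using assms by simp
  fix t assume "t \<ge> K / (lam * \<epsilon>)"
  then have "K \<le> \<epsilon> * (lam * t)"
    using assms by (simp add: field_simps)
  also have "\<dots> < \<epsilon> * exp (lam * t)"
    using assms exp_ge_add_one_self[of "lam * t"] by (intro mult_strict_left_mono) linarith+
  finally show "K * exp (- lam * t) < \<epsilon>"
    by (simp add: exp_minus field_simps)
qed

lemma nn_integral_exp_decay_le:
  fixes lam :: real
  assumes "lam > 0" "K \<ge> 0"
  shows "(\<integral>\<^sup>+t\<in>{0..}. ennreal (K * exp (- lam * t)) \<partial>lebesgue) \<le> ennreal (K / lam)"
proof (rule set_nn_integral_atLeast_le)
  fix T :: real assume "T \<ge> 0"
  have "((\<lambda>t. K * exp (- lam * t)) has_integral (- (K / lam) * exp (- lam * T) - - (K / lam) * exp (- lam * 0))) {0..T}"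
    using assms \<open>T \<ge> 0\<close>
    by (intro fundamental_theorem_of_calculus)
       (auto intro!: derivative_eq_intros simp: has_real_derivative_iff_has_vector_derivative[symmetric])
  then have "integral {0..T} (\<lambda>t. K * exp (- lam * t)) = - (K / lam) * exp (- lam * T) - - (K / lam) * exp (- lam * 0)"
    by (rule integral_unique)
  also have "\<dots> \<le> K / lam"
    using assms by simp
  finally show "ennreal (integral {0..T} (\<lambda>t. K * exp (- lam * t))) \<le> ennreal (K / lam)"
    by (rule ennreal_leI)
qed (use assms in \<open>auto intro!: continuous_intros\<close>)

text \<open>\<open>ennreal\<close> sends negative reals to 0, so only the hypothesis with the
  nonnegative difference has content.\<close>

lemma ennreal_abs_diff_le_max:
  assumes "ennreal (a - b) \<le> I" "ennreal (b - a) \<le> J"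
  shows "ennreal \<bar>a - b\<bar> \<le> max I J"
  using assms by (cases "b \<le> a") (auto simp: le_max_iff_disj abs_if)

lemma abs_integral_le:
  fixes h :: "real \<Rightarrow> real"
  assumes "continuous_on {a..b} h"
  shows "\<bar>integral {a..b} h\<bar> \<le> integral {a..b} (\<lambda>t. \<bar>h t\<bar>)"
proof -
  have "h integrable_on {a..b}" "(\<lambda>t. \<bar>h t\<bar>) integrable_on {a..b}"
    by (intro integrable_continuous_interval continuous_intros assms)+
  from integral_norm_bound_integral[OF this] show ?thesis
    by simp
qed

lemma weighted_sup_bound:
  assumes "g 0 = 0" "z \<in> S"
  shows "ennreal \<bar>g z\<bar> \<le> weighted_sup S g * ennreal (norm z)"
proof (cases "z = 0")
  case False
  have "ennreal \<bar>g z\<bar> = ennreal (\<bar>g z\<bar> / norm z) * ennreal (norm z)"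
    using False by (simp flip: ennreal_mult')
  also have "\<dots> \<le> weighted_sup S g * ennreal (norm z)"
    unfolding weighted_sup_def using False assms by (intro mult_right_mono SUP_upper) auto
  finally show ?thesis .
qed (use assms in simp)

text \<open>The supremum leaves the integral inside \<open>ennreal\<close>, so an infinite one is
  covered; the exponential contributes 1 / lam.\<close>

lemma nn_integral_exp_bound:
  fixes y :: "real \<Rightarrow> real^'d"
  assumes "lam > 0" "C\<^sub>0 > 0" "g 0 = 0"
    and y: "\<And>t. t \<ge> 0 \<Longrightarrow> y t \<in> S \<and> norm (y t) \<le> C\<^sub>0 * exp (- lam * t) * norm x"
  shows "(\<integral>\<^sup>+t\<in>{0..}. ennreal \<bar>g (y t)\<bar> \<partial>lebesgue) \<le> ennreal (C\<^sub>0 / lam) * weighted_sup S g * ennreal (norm x)"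
proof -
  let ?W = "weighted_sup S g" and ?h = "\<lambda>t. ennreal (C\<^sub>0 * norm x * exp (- lam * t)) * indicator {0..} t"
  have "(\<integral>\<^sup>+t\<in>{0..}. ennreal \<bar>g (y t)\<bar> \<partial>lebesgue) \<le> (\<integral>\<^sup>+t. ?W * ?h t \<partial>lebesgue)"
  proof (rule nn_integral_mono)
    fix t :: real
    show "ennreal \<bar>g (y t)\<bar> * indicator {0..} t \<le> ?W * ?h t"
    proof (cases "t \<ge> 0")
      case True
      then have "ennreal \<bar>g (y t)\<bar> \<le> ?W * ennreal (norm (y t))"
        using y assms by (intro weighted_sup_bound) auto
      also have "\<dots> \<le> ?W * ennreal (C\<^sub>0 * norm x * exp (- lam * t))"
        using y[OF True] by (intro mult_left_mono ennreal_leI) (auto simp: mult_ac)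
      finally show ?thesis
        using True by simp
    qed simp
  qed
  also have "\<dots> = ?W * (\<integral>\<^sup>+t. ?h t \<partial>lebesgue)"
    unfolding nn_integral_completion by (rule nn_integral_cmult) measurable
  also have "\<dots> \<le> ?W * ennreal (C\<^sub>0 * norm x / lam)"
    using assms by (intro mult_left_mono nn_integral_exp_decay_le) auto
  also have "ennreal (C\<^sub>0 * norm x / lam) = ennreal (C\<^sub>0 / lam) * ennreal (norm x)"
    using assms by (simp flip: ennreal_mult)
  finally show ?thesis
    by (simp add: mult_ac)
qed

section \<open>Residual and Lyapunov form near the origin; comparison of \<open>VS\<close> with
  costs\<close>

context sdre
begin

text \<open>\<open>E\<close> is the inner product of \<open>phi\<close>, bounded by a multiple of
  |y|^2, with \<open>drift\<close>, which is continuous and vanishes at 0.\<close>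

lemma residual_little_o:
  assumes "0 \<in> \<O>" "\<epsilon> > 0"
  shows "\<forall>\<^sub>F y in nhds 0. \<bar>E y\<bar> \<le> \<epsilon> * (norm y)\<^sup>2"
proof -
  define drift where "drift x = A x *v x - B x *v (matrix_inv R *v (transpose (B x) *v (P x *v x)))
     - (1/4) *\<^sub>R (B x *v (matrix_inv R *v (transpose (B x) *v phi P x)))" for x
  \<comment> \<open>Near 0 each partial derivative of P exceeds its norm at 0 by at most 1. The
    later division by K + 1 makes the factor K / (K + 1) at most 1.\<close>
  define K where "K = (\<Sum>i\<in>UNIV. norm (pderivative P i 0) + 1)"
  have "K \<ge> 0"
    unfolding K_def by (intro sum_nonneg) simp
  have "drift 0 = 0"
    by (simp add: drift_def phi_def vec_eq_iff[of _ 0] matrix_vector_mult_def)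
  moreover have "continuous_on \<O> drift"
    unfolding drift_def by (rule cont_drift)
  ultimately have "\<forall>\<^sub>F y in nhds 0. norm (drift y) < \<epsilon> / (K + 1)"
    using eventually_near_of_continuous_on[of \<O> drift 0 "\<epsilon> / (K + 1)"] open_O assms \<open>K \<ge> 0\<close> by simp
  moreover have "\<forall>\<^sub>F y in nhds 0. \<forall>i. dist (pderivative P i y) (pderivative P i 0) < 1"
    by (intro eventually_all_finite eventually_near_of_continuous_on[OF continuous_on_pderivative[OF C1_P] open_O assms(1)]) simp
  ultimately show ?thesis
  proof eventually_elim
    case (elim y)
    have "norm (phi P y) \<le> (\<Sum>i\<in>UNIV. \<bar>phi P y $ i\<bar>)"
      by (rule norm_le_l1_cart)
    also have "\<dots> \<le> (\<Sum>i\<in>UNIV. (norm (pderivative P i 0) + 1) * (norm y)\<^sup>2)"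
    proof (rule sum_mono)
      fix i
      have "\<bar>phi P y $ i\<bar> \<le> norm y * norm (pderivative P i y *v y)"
        by (simp add: phi_def Cauchy_Schwarz_ineq2)
      also have "\<dots> \<le> norm y * (norm (pderivative P i y) * norm y)"
        by (intro mult_left_mono norm_matrix_vector_mult) simp
      also have "\<dots> = norm (pderivative P i y) * (norm y)\<^sup>2"
        by (simp add: power2_eq_square)
      also have "\<dots> \<le> (norm (pderivative P i 0) + 1) * (norm y)\<^sup>2"
        using elim(2)[rule_format, of i] norm_triangle_sub[of "pderivative P i y" "pderivative P i 0"]
        by (intro mult_right_mono) (auto simp: dist_norm)
      finally show "\<bar>phi P y $ i\<bar> \<le> (norm (pderivative P i 0) + 1) * (norm y)\<^sup>2" .
    qed
    finally have phi: "norm (phi P y) \<le> K * (norm y)\<^sup>2"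
      by (simp only: K_def sum_distrib_right)
    have "\<bar>E y\<bar> \<le> norm (phi P y) * norm (drift y)"
      unfolding residual_nested drift_def by (rule Cauchy_Schwarz_ineq2)
    also have "\<dots> \<le> K * (norm y)\<^sup>2 * (\<epsilon> / (K + 1))"
      using phi elim(1) \<open>K \<ge> 0\<close> by (intro mult_mono) auto
    also have "\<dots> = K / (K + 1) * (\<epsilon> * (norm y)\<^sup>2)"
      by simp
    also have "\<dots> \<le> 1 * (\<epsilon> * (norm y)\<^sup>2)"
      using \<open>K \<ge> 0\<close> \<open>\<epsilon> > 0\<close> by (intro mult_right_mono) auto
    finally show ?case by simp
  qed
qed

text \<open>Detectability gives L such that the transpose of A(0) - L^T C is Hurwitz. Along A(0) -
  L^T C the form decreases at rate 2 c |y|^2; the output term takes c/4 of it, the control c/4 and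
  the variation of A c/2, so c is left. What Young's inequality puts on C y and u is paid by the
  running cost.\<close>

lemma lyapunov_data_exists:
  assumes "0 \<in> \<O>" and C: "psd C" "C ** C = Q" and "detectable (A 0) C"
  obtains m a c k \<rho> where "lyapunov_data m a c k \<rho>"
proof -
  obtain L where L: "\<And>\<mu>. is_eigenvalue (transpose (A 0) - transpose C ** L) \<mu> \<Longrightarrow> Re \<mu> < 0"
    using assms(4) by (auto simp: detectable_def stabilizable_def)
  obtain m a c where m: "linear m" "\<And>x y. x \<bullet> m y = m x \<bullet> y" and pos: "a > 0" "c > 0"
    and lower: "\<And>x. a * (norm x)\<^sup>2 \<le> x \<bullet> m x"
    and decay: "\<And>x. x \<bullet> m (transpose (transpose (A 0) - transpose C ** L) *v x) \<le> - c * (norm x)\<^sup>2"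
    using hurwitz_lyapunov[of "transpose (A 0) - transpose C ** L", OF L] by blast
  have F: "transpose (transpose (A 0) - transpose C ** L) = A 0 - transpose L ** C"
    by (simp add: vec_eq_iff transpose_def matrix_matrix_mult_def mult.commute)
  obtain M where M: "M > 0" "\<And>x. norm (m x) \<le> norm x * M"
    using linear_bounded_pos[OF m(1)] by (metis mult.commute)
  obtain r where r: "r > 0" "\<And>u. r * (norm u)\<^sup>2 \<le> u \<bullet> (R *v u)"
    using posdef_coercive[OF posdef_R] by blast
  define l where "l = norm (transpose L)"
  define b where "b = norm (B 0) + 1"
  \<comment> \<open>The first term pays for |C y|^2 = y . Q y, the second for |u|^2 \<le> u . R u /
    r; the 1 makes k positive.\<close>
  define k where "k = 4 * (M * l)\<^sup>2 / c + 4 * (M * b)\<^sup>2 / c / r + 1"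
  have k: "k > 0" "4 * (M * l)\<^sup>2 / c \<le> k" "4 * (M * b)\<^sup>2 / c \<le> k * r"
  proof -
    show "k > 0"
      unfolding k_def using pos r by (intro add_nonneg_pos add_nonneg_nonneg) auto
    show "4 * (M * l)\<^sup>2 / c \<le> k"
      using pos r by (simp add: k_def)
    have "4 * (M * b)\<^sup>2 / c = 4 * (M * b)\<^sup>2 / c / r * r"
      using r by simp
    also have "\<dots> \<le> k * r"
      using pos r by (intro mult_right_mono) (auto simp: k_def)
    finally show "4 * (M * b)\<^sup>2 / c \<le> k * r" .
  qed
  \<comment> \<open>The tolerance c / (4 M) limits the error from A to c/2 |y|^2; the rate c / k is
    the one that \<open>lyapunov_data\<close> demands of the residual.\<close>
  have "\<forall>\<^sub>F y in nhds 0. y \<in> \<O> \<and> dist (A y) (A 0) < c / (4 * M) \<and> dist (B y) (B 0) < 1 \<and>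
      \<bar>E y\<bar> \<le> c / k * (norm y)\<^sup>2"
    using M pos k open_O \<open>0 \<in> \<O>\<close> cont_A cont_B
    by (intro eventually_conj residual_little_o eventually_near_of_continuous_on[of \<O>] eventually_nhds_in_open) auto
  then obtain \<rho> where \<rho>: "\<rho> > 0" and near: "\<And>y. norm y \<le> \<rho> \<Longrightarrow>
      y \<in> \<O> \<and> dist (A y) (A 0) < c / (4 * M) \<and> dist (B y) (B 0) < 1 \<and> \<bar>E y\<bar> \<le> c / k * (norm y)\<^sup>2"
    unfolding eventually_nhds_metric_le by (auto simp: dist_norm)
  have "2 * (m y \<bullet> (f y + B y *v u)) \<le> - c * (norm y)\<^sup>2 + k * cost_rate y u" if "norm y \<le> \<rho>" for y u
  proof -
    have y: "y \<in> \<O>" "norm (A y - A 0) \<le> c / (4 * M)" "norm (B y) \<le> b"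
      using near[OF that] norm_triangle_sub[of "B y" "B 0"] by (auto simp: dist_norm b_def)
    have my: "m y \<bullet> z \<le> M * norm y * norm z" for z
      using norm_cauchy_schwarz[of "m y" z] mult_right_mono[OF M(2)[of y] norm_ge_zero[of z]]
      by (simp add: mult_ac)
    have "f y + B y *v u = (A 0 - transpose L ** C) *v y + transpose L *v (C *v y) + (A y - A 0) *v y + B y *v u"
      unfolding fA[OF y(1)] matrix_vector_mult_diff_rdistrib matrix_vector_mul_assoc by simp
    then have "2 * (m y \<bullet> (f y + B y *v u)) = 2 * (m y \<bullet> ((A 0 - transpose L ** C) *v y))
        + 2 * (m y \<bullet> (transpose L *v (C *v y))) + 2 * (m y \<bullet> ((A y - A 0) *v y)) + 2 * (m y \<bullet> (B y *v u))"
      by (simp only: inner_add_right distrib_left)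
    moreover have "m y \<bullet> ((A 0 - transpose L ** C) *v y) \<le> - c * (norm y)\<^sup>2"
      using decay[of y] unfolding F m(2) .
    moreover have "2 * (m y \<bullet> (transpose L *v (C *v y))) \<le> c/4 * (norm y)\<^sup>2 + 4 * (M * l)\<^sup>2 / c * (norm (C *v y))\<^sup>2"
    proof -
      have "m y \<bullet> (transpose L *v (C *v y)) \<le> M * norm y * (l * norm (C *v y))"
        using M unfolding l_def
        by (intro order_trans[OF my] mult_left_mono norm_matrix_vector_mult) auto
      then show ?thesis
        using young_inequality[OF pos(2), of "M * l" "norm y" "norm (C *v y)"] by (simp add: mult_ac)
    qed
    moreover have "2 * (m y \<bullet> (B y *v u)) \<le> c/4 * (norm y)\<^sup>2 + 4 * (M * b)\<^sup>2 / c * (norm u)\<^sup>2"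
    proof -
      have "m y \<bullet> (B y *v u) \<le> M * norm y * (norm (B y) * norm u)"
        using M by (intro order_trans[OF my] mult_left_mono norm_matrix_vector_mult) auto
      also have "\<dots> \<le> M * norm y * (b * norm u)"
        using M y by (intro mult_left_mono mult_right_mono) auto
      finally show ?thesis
        using young_inequality[OF pos(2), of "M * b" "norm y" "norm u"] by (simp add: mult_ac)
    qed
    moreover have "2 * (m y \<bullet> ((A y - A 0) *v y)) \<le> c/2 * (norm y)\<^sup>2"
    proof -
      have "m y \<bullet> ((A y - A 0) *v y) \<le> M * norm y * (norm (A y - A 0) * norm y)"
        using M by (intro order_trans[OF my] mult_left_mono norm_matrix_vector_mult) auto
      also have "\<dots> \<le> M * norm y * (c / (4 * M) * norm y)"
        using M y by (intro mult_left_mono mult_right_mono) auto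
      finally show ?thesis
        using M by (simp add: power2_eq_square mult_ac)
    qed
    moreover have "4 * (M * l)\<^sup>2 / c * (norm (C *v y))\<^sup>2 \<le> k * (y \<bullet> (Q *v y))"
    proof -
      have "transpose C = C"
        using C by (simp add: psd_def)
      from inner_symmetric_matrix[OF this, of y "C *v y"]
      have "y \<bullet> (Q *v y) = (norm (C *v y))\<^sup>2"
        by (simp add: C(2)[symmetric] matrix_vector_mul_assoc[symmetric] power2_norm_eq_inner)
      then show ?thesis
        using k by (intro mult_mono) auto
    qed
    moreover have "4 * (M * b)\<^sup>2 / c * (norm u)\<^sup>2 \<le> k * (u \<bullet> (R *v u))"
    proof -
      have "4 * (M * b)\<^sup>2 / c * (norm u)\<^sup>2 \<le> k * r * (norm u)\<^sup>2"
        using k by (intro mult_right_mono) auto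
      also have "\<dots> \<le> k * (u \<bullet> (R *v u))"
        using mult_left_mono[OF r(2)[of u], of k] k by (simp add: mult_ac)
      finally show ?thesis .
    qed
    ultimately show ?thesis
      unfolding running_cost_def distrib_left by linarith
  qed
  moreover have "k * \<bar>E y\<bar> \<le> c * (norm y)\<^sup>2" if "norm y \<le> \<rho>" for y
    using mult_left_mono[of "\<bar>E y\<bar>" "c / k * (norm y)\<^sup>2" k] near[OF that] k by simp
  ultimately have "lyapunov_data m a c k \<rho>"
    using m pos lower k(1) \<rho> near unfolding lyapunov_data_def by auto
  then show ?thesis
    using that by blast
qed

text \<open>\<open>VS_le_cost\<close> bounds \<open>VS (y 0)\<close> for every T, with
  \<open>VS (y T)\<close> as the only term depending on T. Times at which y is near 0 make that term
  arbitrarily small.\<close>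

lemma VS_minus_cost_le:
  assumes y: "\<And>t. t \<ge> 0 \<Longrightarrow> y t \<in> \<O>"
      "\<And>t. t \<ge> 0 \<Longrightarrow> (y has_vector_derivative (f (y t) + B (y t) *v w t)) (at t within {0..})"
    and w: "continuous_on {0..} w"
    and cost: "(\<integral>\<^sup>+t\<in>{0..}. ennreal (cost_rate (y t) (w t)) \<partial>lebesgue) \<le> ennreal v" "v \<ge> 0"
    and small: "\<And>\<epsilon>. \<epsilon> > 0 \<Longrightarrow> \<exists>T\<ge>0. norm (y T) < \<epsilon>" and "0 \<in> \<O>"
  shows "ennreal (VS (y 0) - v) \<le> (\<integral>\<^sup>+t\<in>{0..}. ennreal \<bar>E (y t)\<bar> \<partial>lebesgue)"
proof (cases "\<integral>\<^sup>+t\<in>{0..}. ennreal \<bar>E (y t)\<bar> \<partial>lebesgue")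
  case (real e)
  have cont_y: "continuous_on {0..} y"
    by (rule continuous_on_vector_derivative) (use y(2) in auto)
  have cE: "continuous_on {0..} (\<lambda>t. E (y t))"
    by (rule continuous_on_compose2[OF cont_E cont_y]) (use y(1) in auto)
  have bound: "VS (y 0) \<le> VS (y T) + v + e" if "T \<ge> 0" for T
  proof -
    have "ennreal (integral {0..T} (\<lambda>t. cost_rate (y t) (w t))) \<le> ennreal v"
      using cost(1) running_cost_nonneg[OF psd_Q posdef_R]
      by (intro order_trans[OF set_nn_integral_atLeast_ge] cont_cost_rate cont_y w)
    then have c: "integral {0..T} (\<lambda>t. cost_rate (y t) (w t)) \<le> v"
      using cost(2) by simp
    have "ennreal (integral {0..T} (\<lambda>t. \<bar>E (y t)\<bar>)) \<le> ennreal e"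
      unfolding real(2)[symmetric] by (intro set_nn_integral_atLeast_ge continuous_intros cE) simp
    then have e: "integral {0..T} (\<lambda>t. \<bar>E (y t)\<bar>) \<le> e"
      using real(1) by simp
    have "\<bar>integral {0..T} (\<lambda>t. E (y t))\<bar> \<le> integral {0..T} (\<lambda>t. \<bar>E (y t)\<bar>)"
      by (rule abs_integral_le) (auto intro: continuous_on_subset[OF cE])
    moreover have "VS (y 0) \<le> VS (y T) + integral {0..T} (\<lambda>t. cost_rate (y t) (w t)) - integral {0..T} (\<lambda>t. E (y t))"
      by (rule VS_le_cost[OF that solves_onI]) (use y in \<open>auto intro: continuous_on_subset[OF w]\<close>)
    ultimately show ?thesis
      using c e by linarith
  qed
  have "VS (y 0) \<le> v + e"
  proof (rule field_le_epsilon)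
    fix \<eta> :: real assume "\<eta> > 0"
    moreover have "VS 0 = 0"
      by (simp add: sdre_value_def)
    ultimately have "\<forall>\<^sub>F z in nhds 0. VS z < \<eta>"
      by (intro eventually_less_of_continuous_on[OF cont_VS open_O \<open>0 \<in> \<O>\<close>]) simp
    then obtain d where "d > 0" "\<And>z. norm z < d \<Longrightarrow> VS z < \<eta>"
      unfolding eventually_nhds_metric by auto
    moreover then obtain T where "T \<ge> 0" "norm (y T) < d"
      using small by blast
    ultimately show "VS (y 0) \<le> v + e + \<eta>"
      using bound[of T] by fastforce
  qed
  then show ?thesis
    unfolding real(2) by (intro ennreal_leI) simp
qed simp

lemma cost_le_VS_plus:
  assumes cl: "closed_loop_trajectory f B uS \<O> x y"
  shows "cost Q R y (\<lambda>t. uS (y t)) \<le> ennreal (VS x) + (\<integral>\<^sup>+t\<in>{0..}. ennreal \<bar>E (y t)\<bar> \<partial>lebesgue)"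
proof -
  have y0: "y 0 = x" and y: "\<And>t. t \<ge> 0 \<Longrightarrow> y t \<in> \<O>"
    and dy: "\<And>t. t \<ge> 0 \<Longrightarrow> (y has_vector_derivative (f (y t) + B (y t) *v uS (y t))) (at t within {0..})"
    using cl by (auto simp: closed_loop_trajectory_def)
  have cont_y: "continuous_on {0..} y"
    by (rule continuous_on_vector_derivative) (use dy in auto)
  have cE: "continuous_on {0..} (\<lambda>t. E (y t))" and cu: "continuous_on {0..} (\<lambda>t. uS (y t))"
    using continuous_on_compose2[OF cont_E cont_y] continuous_on_compose2[OF cont_uS cont_y] y by blast+
  have "(\<integral>\<^sup>+t\<in>{0..}. ennreal (cost_rate (y t) (uS (y t))) \<partial>lebesgue)
      \<le> ennreal (VS x) + (\<integral>\<^sup>+t\<in>{0..}. ennreal \<bar>E (y t)\<bar> \<partial>lebesgue)"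
  proof (rule set_nn_integral_atLeast_le)
    fix T :: real assume T: "T \<ge> 0"
    have "\<bar>integral {0..T} (\<lambda>t. E (y t))\<bar> \<le> integral {0..T} (\<lambda>t. \<bar>E (y t)\<bar>)"
      by (rule abs_integral_le) (auto intro: continuous_on_subset[OF cE])
    moreover have "integral {0..T} (\<lambda>t. cost_rate (y t) (uS (y t)))
        = VS (y 0) - VS (y T) + integral {0..T} (\<lambda>t. E (y t))"
      by (rule feedback_cost[OF T solves_onI]) (use dy y in auto)
    ultimately have "integral {0..T} (\<lambda>t. cost_rate (y t) (uS (y t))) \<le> VS x + integral {0..T} (\<lambda>t. \<bar>E (y t)\<bar>)"
      using VS_nonneg[OF y[OF T]] unfolding y0 by linarith
    then have "ennreal (integral {0..T} (\<lambda>t. cost_rate (y t) (uS (y t))))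
        \<le> ennreal (VS x) + ennreal (integral {0..T} (\<lambda>t. \<bar>E (y t)\<bar>))"
      using VS_nonneg[of x] y[of 0] y0
      by (subst ennreal_plus[symmetric])
         (auto intro!: ennreal_leI integral_nonneg integrable_continuous_interval continuous_intros continuous_on_subset[OF cE])
    also have "\<dots> \<le> ennreal (VS x) + (\<integral>\<^sup>+t\<in>{0..}. ennreal \<bar>E (y t)\<bar> \<partial>lebesgue)"
      by (intro add_left_mono set_nn_integral_atLeast_ge continuous_intros cE) simp
    finally show "ennreal (integral {0..T} (\<lambda>t. cost_rate (y t) (uS (y t))))
        \<le> ennreal (VS x) + (\<integral>\<^sup>+t\<in>{0..}. ennreal \<bar>E (y t)\<bar> \<partial>lebesgue)" .
  qed (auto intro: cont_cost_rate cont_y cu running_cost_nonneg psd_Q posdef_R)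
  then show ?thesis
    by (simp add: cost_def running_cost_def)
qed

text \<open>The feedback competes in the infimum once it is an admissible control, which is the
  purpose of the bound \<open>M\<close>.\<close>

lemma value_le_VS_plus:
  assumes cl: "closed_loop_trajectory f B uS \<O> x y" and bounded: "\<And>t. t \<ge> 0 \<Longrightarrow> norm (uS (y t)) \<le> M"
  shows "value_function f B Q R x \<le> ennreal (VS x) + (\<integral>\<^sup>+t\<in>{0..}. ennreal \<bar>E (y t)\<bar> \<partial>lebesgue)"
proof -
  have y0: "y 0 = x" and y: "\<And>t. t \<ge> 0 \<Longrightarrow> y t \<in> \<O>"
    and dy: "\<And>t. t \<ge> 0 \<Longrightarrow> (y has_vector_derivative (f (y t) + B (y t) *v uS (y t))) (at t within {0..})"
    using cl by (auto simp: closed_loop_trajectory_def)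
  have cont_y: "continuous_on {0..} y"
    by (rule continuous_on_vector_derivative) (use dy in auto)
  have cu: "continuous_on {0..} (\<lambda>t. uS (y t))"
    using continuous_on_compose2[OF cont_uS cont_y] y by blast
  have "admissible (\<lambda>t. uS (y t))"
    unfolding admissible_def
  proof
    show "(\<lambda>t. uS (y t)) \<in> borel_measurable (lebesgue_on {0..})"
      by (rule continuous_imp_measurable_on_sets_lebesgue[OF cu]) simp
    show "\<exists>M. AE s in lebesgue_on {0..}. norm (uS (y s)) \<le> M"
      using bounded by (intro exI[of _ M] AE_I2) (simp add: space_restrict_space)
  qed
  moreover have "state_trajectory f B x (\<lambda>t. uS (y t)) y"
    unfolding state_trajectory_def
  proof (intro conjI allI impI cont_y)
    fix t :: real assume "t \<ge> 0"
    then have "((\<lambda>s. f (y s) + B (y s) *v uS (y s)) has_integral (y t - y 0)) {0..t}"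
      using has_vector_derivative_within_subset[OF dy] by (intro fundamental_theorem_of_calculus) auto
    then show "((\<lambda>s. f (y s) + B (y s) *v uS (y s)) has_integral (y t - x)) {0..t}"
      by (simp add: y0)
  qed
  ultimately have "value_function f B Q R x \<le> cost Q R y (\<lambda>t. uS (y t))"
    unfolding value_function_def by (intro Inf_lower) blast
  also note cost_le_VS_plus[OF cl]
  finally show ?thesis .
qed

end

section \<open>Trapped trajectories and boundedness of the feedback along them\<close>

context sdre
begin

text \<open>The first conclusion drops the integral of |y|^2 from the energy estimate. The second
  keeps it: if |y| stayed above \<epsilon>, the integral would grow linearly past the fixed
  bound.\<close>

lemma trapped_trajectory:
  assumes L: "lyapunov_data m a c k \<rho>"
    and dy: "\<And>t. t \<ge> 0 \<Longrightarrow> (y has_vector_derivative (f (y t) + B (y t) *v w t)) (at t within {0..})"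
    and w: "continuous_on {0..} w"
    and cost: "\<And>T. T \<ge> 0 \<Longrightarrow> integral {0..T} (\<lambda>t. cost_rate (y t) (w t)) \<le> v"
    and small: "norm (y 0) < \<rho>" "y 0 \<bullet> m (y 0) + k * v < a * \<rho>\<^sup>2"
  shows "\<And>t. t \<ge> 0 \<Longrightarrow> norm (y t) < \<rho>" "\<And>\<epsilon>. \<epsilon> > 0 \<Longrightarrow> \<exists>T\<ge>0. norm (y T) < \<epsilon>"
proof -
  have pos: "a > 0" "c > 0" "k > 0" and lower: "\<And>x. a * (norm x)\<^sup>2 \<le> x \<bullet> m x"
    using L by (auto simp: lyapunov_data_def)
  have cont_y: "continuous_on {0..} y"
    by (rule continuous_on_vector_derivative) (use dy in auto)
  have energy: "y T \<bullet> m (y T) + c * integral {0..T} (\<lambda>t. (norm (y t))\<^sup>2) \<le> y 0 \<bullet> m (y 0) + k * v"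
    if T: "T \<ge> 0" "\<And>t. t \<in> {0..T} \<Longrightarrow> norm (y t) \<le> \<rho>" for T
  proof -
    have "continuous_on {0..T} w"
      by (rule continuous_on_subset[OF w]) auto
    from energy_estimate[OF L T(1) solves_onI[OF dy] T(2) this]
    have "y T \<bullet> m (y T) + c * integral {0..T} (\<lambda>t. (norm (y t))\<^sup>2)
        \<le> y 0 \<bullet> m (y 0) + k * integral {0..T} (\<lambda>t. cost_rate (y t) (w t))"
      by blast
    also have "\<dots> \<le> y 0 \<bullet> m (y 0) + k * v"
      using cost[OF T(1)] pos by simp
    finally show ?thesis .
  qed
  show ball: "norm (y t) < \<rho>" if "t \<ge> 0" for t
  proof (rule trapped[OF L cont_y small])
    fix T :: real assume T: "T \<ge> 0" "\<And>t. t \<in> {0..T} \<Longrightarrow> norm (y t) \<le> \<rho>"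
    have "0 \<le> c * integral {0..T} (\<lambda>t. (norm (y t))\<^sup>2)"
      using pos by (intro mult_nonneg_nonneg integral_nonneg integrable_continuous_interval
          continuous_intros continuous_on_subset[OF cont_y]) auto
    then show "y T \<bullet> m (y T) \<le> y 0 \<bullet> m (y 0) + k * v"
      using energy[OF T] by linarith
  qed (rule that)
  show "\<exists>T\<ge>0. norm (y T) < \<epsilon>" if "\<epsilon> > 0" for \<epsilon>
  proof (rule ccontr)
    assume "\<not> (\<exists>T\<ge>0. norm (y T) < \<epsilon>)"
    then have far: "\<epsilon> \<le> norm (y t)" if "t \<ge> 0" for t
      using that by force
    have z: "c * \<epsilon>\<^sup>2 * T \<le> y 0 \<bullet> m (y 0) + k * v" if "T \<ge> 0" for T
    proof -
      have "((\<lambda>t. \<epsilon>\<^sup>2) has_integral (T * \<epsilon>\<^sup>2)) {0..T}"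
        using has_integral_const_real[of "\<epsilon>\<^sup>2" 0 T] that by simp
      moreover have "((\<lambda>t. (norm (y t))\<^sup>2) has_integral integral {0..T} (\<lambda>t. (norm (y t))\<^sup>2)) {0..T}"
        by (intro integrable_integral integrable_continuous_interval
          continuous_intros continuous_on_subset[OF cont_y]) auto
      ultimately have "T * \<epsilon>\<^sup>2 \<le> integral {0..T} (\<lambda>t. (norm (y t))\<^sup>2)"
        by (rule has_integral_le) (use far \<open>\<epsilon> > 0\<close> in \<open>auto intro!: power_mono\<close>)
      then have "c * (T * \<epsilon>\<^sup>2) \<le> c * integral {0..T} (\<lambda>t. (norm (y t))\<^sup>2)"
        using pos by (intro mult_left_mono) auto
      moreover have "0 \<le> y T \<bullet> m (y T)"
        using lower[of "y T"] pos by (intro order_trans[OF _ lower]) auto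
      moreover have "y T \<bullet> m (y T) + c * integral {0..T} (\<lambda>t. (norm (y t))\<^sup>2) \<le> y 0 \<bullet> m (y 0) + k * v"
        by (rule energy[OF that]) (use ball in \<open>auto intro: less_imp_le\<close>)
      ultimately show ?thesis
        by (simp add: mult_ac)
    qed
    define Z K where "Z = y 0 \<bullet> m (y 0) + k * v" and "K = c * \<epsilon>\<^sup>2"
    have "0 \<le> Z" "0 < K"
      using z[of 0] pos \<open>\<epsilon> > 0\<close> by (simp_all add: Z_def K_def)
    \<comment> \<open>At this time the lower bound is Z + K, which exceeds Z.\<close>
    then show False
      using z[of "Z / K + 1"] unfolding Z_def[symmetric] K_def[symmetric] by (simp add: distrib_left)
  qed
qed

text \<open>Covers every closed-loop solution and not only the one from Peano's theorem, since the
  first estimate is claimed for all of them.\<close>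

lemma closed_loop_norm_less:
  assumes L: "lyapunov_data m a c k \<rho>" and cl: "closed_loop_trajectory f B uS \<O> x y"
    and small: "norm x < \<rho>" "x \<bullet> m x + k * VS x < a * \<rho>\<^sup>2" and "t \<ge> 0"
  shows "norm (y t) < \<rho>"
proof -
  have y0: "y 0 = x"
    and dy: "\<And>t. t \<ge> 0 \<Longrightarrow> (y has_vector_derivative (f (y t) + B (y t) *v uS (y t))) (at t within {0..})"
    using cl by (auto simp: closed_loop_trajectory_def)
  have cont_y: "continuous_on {0..} y"
    by (rule continuous_on_vector_derivative) (use dy in auto)
  show ?thesis
  proof (rule trapped[OF L cont_y _ _ _ \<open>t \<ge> 0\<close>])
    fix T :: real assume T: "T \<ge> 0" "\<And>t. t \<in> {0..T} \<Longrightarrow> norm (y t) \<le> \<rho>"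
    show "y T \<bullet> m (y T) \<le> y 0 \<bullet> m (y 0) + k * VS x"
      using feedback_energy[OF L T(1) solves_onI[OF dy] T(2)] unfolding y0 by blast
  qed (use small y0 in auto)
qed

text \<open>\<open>uS\<close> might be unbounded near the boundary of \<open>\<O>\<close>. Two
  compact sets cover the trajectory: its arc over [0,T] and the ball that contains it
  afterwards.\<close>

lemma feedback_bounded:
  assumes cl: "closed_loop_trajectory f B uS \<O> x y"
    and ball: "cball 0 \<rho> \<subseteq> \<O>" and late: "\<And>t. t \<ge> T \<Longrightarrow> norm (y t) \<le> \<rho>"
  obtains M where "\<And>t. t \<ge> 0 \<Longrightarrow> norm (uS (y t)) \<le> M"
proof -
  have y: "\<And>t. t \<ge> 0 \<Longrightarrow> y t \<in> \<O>"
    and dy: "\<And>t. t \<ge> 0 \<Longrightarrow> (y has_vector_derivative (f (y t) + B (y t) *v uS (y t))) (at t within {0..})"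
    using cl by (auto simp: closed_loop_trajectory_def)
  have cont_y: "continuous_on {0..} y"
    by (rule continuous_on_vector_derivative) (use dy in auto)
  have cu: "continuous_on {0..} (\<lambda>t. uS (y t))"
    using continuous_on_compose2[OF cont_uS cont_y] y by blast
  have "bounded ((\<lambda>t. uS (y t)) ` {0..T})" "bounded (uS ` cball 0 \<rho>)"
    by (auto intro!: compact_imp_bounded compact_continuous_image continuous_on_subset[OF cu]
        continuous_on_subset[OF cont_uS ball])
  then obtain M1 M2 where M1: "\<forall>v\<in>(\<lambda>t. uS (y t)) ` {0..T}. norm v \<le> M1"
    and M2: "\<forall>v\<in>uS ` cball 0 \<rho>. norm v \<le> M2"
    unfolding bounded_iff by (elim exE)
  have "norm (uS (y t)) \<le> max M1 M2" if "t \<ge> 0" for t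
  proof (cases "t \<le> T")
    case True
    then show ?thesis
      using M1 that by (auto intro: max.coboundedI1)
  next
    case False
    then show ?thesis
      using M2 late[of t] by (auto intro: max.coboundedI2)
  qed
  then show ?thesis
    using that by blast
qed

end

theorem proposition3p1:
  fixes f :: "real^'d \<Rightarrow> real^'d" and B :: "real^'d \<Rightarrow> real^'m^'d"
    and A P :: "real^'d \<Rightarrow> real^'d^'d"
    and Q Qhalf :: "real^'d^'d" and R :: "real^'m^'m"
    and V :: "real^'d \<Rightarrow> real" and E :: "real^'d \<Rightarrow> real"
    and D \<O> :: "(real^'d) set" and r :: real
    and ystar :: "real^'d \<Rightarrow> real \<Rightarrow> real^'d"
    and ustar uS :: "real^'d \<Rightarrow> real^'m"
  defines "V \<equiv> \<lambda>x. enn2real (value_function f B Q R x)"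
    and "E \<equiv> residual A B R P"
    and "ustar \<equiv> feedback B R V"
    and "uS \<equiv> feedback B R (sdre_value P)"
  assumes f_C1: "C1_on UNIV f" and B_C1: "C1_on UNIV B" and f0: "f 0 = 0"
    and Q: "psd Q" and R: "posdef R"
    and Qhalf: "psd Qhalf" "Qhalf ** Qhalf = Q"
    and D: "open D" "0 \<in> D"
    and V_finite: "\<forall>x\<in>D. value_function f B Q R x < \<infinity>"
    and V_C1: "C1_on D V"
    and ystar: "\<forall>x\<in>D. closed_loop_trajectory f B ustar D x (ystar x) \<and>
                  admissible (\<lambda>t. ustar (ystar x t)) \<and>
                  cost Q R (ystar x) (\<lambda>t. ustar (ystar x t)) = value_function f B Q R x"
    and r: "r > 0"
    and f_cont: "continuous_on (cball 0 r) f"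
    and df_cont: "\<forall>j. continuous_on (cball 0 r) (pderivative f j)"
    and A_cont: "continuous_on (cball 0 r) A" and B_cont: "continuous_on (cball 0 r) B"
    and fA: "\<forall>x\<in>cball 0 r. f x = A x *v x"
    and \<O>: "open \<O>" "0 \<in> \<O>" "\<O> \<subseteq> ball 0 r"
    and stab: "\<forall>x\<in>\<O>. stabilizable (A x) (B x)"
    and detect: "\<forall>x\<in>\<O>. detectable (A x) Qhalf"
    and P: "\<forall>x\<in>\<O>. {X. psd X \<and> riccati (A x) (B x) Q R X = 0} = {P x}"
    and P_C1: "C1_on \<O> P"
  shows
    "(\<exists>N. open N \<and> 0 \<in> N \<and> N \<subseteq> \<O> \<inter> D \<and>
       (\<forall>x\<in>N.
          (\<forall>t\<ge>0. ystar x t \<in> \<O>) \<and>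
          (\<exists>yS. closed_loop_trajectory f B uS \<O> x yS) \<and>
          (\<forall>yS. closed_loop_trajectory f B uS \<O> x yS \<longrightarrow>
             ennreal \<bar>sdre_value P x - V x\<bar> \<le>
               max (\<integral>\<^sup>+t\<in>{0..}. ennreal \<bar>E (ystar x t)\<bar> \<partial>lebesgue)
                   (\<integral>\<^sup>+t\<in>{0..}. ennreal \<bar>E (yS t)\<bar> \<partial>lebesgue))))
     \<and>
     (\<forall>\<Omega> yS C\<^sub>0 lam.
        0 \<in> interior \<Omega> \<and> \<Omega> \<subseteq> \<O> \<inter> D \<and> C\<^sub>0 > 0 \<and> lam > 0 \<and>
        (\<forall>x\<in>\<Omega>. closed_loop_trajectory f B uS \<Omega> x (yS x) \<and>
           (\<forall>t\<ge>0. ystar x t \<in> \<Omega> \<and>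
              norm (ystar x t) \<le> C\<^sub>0 * exp (- lam * t) * norm x \<and>
              norm (yS x t) \<le> C\<^sub>0 * exp (- lam * t) * norm x))
        \<longrightarrow> (\<exists>C>0. \<forall>x\<in>\<Omega>.
               ennreal \<bar>sdre_value P x - V x\<bar>
                 \<le> ennreal (C / lam) * weighted_sup \<Omega> E * ennreal (norm x)))"
proof -
  have O_sub: "\<O> \<subseteq> cball 0 r"
    using \<O>(3) by auto
  interpret sdre f B A P Q R \<O>
  proof
    show "open \<O>" "posdef R" "psd Q" "C1_on \<O> P"
      by fact+
    show "continuous_on \<O> f" "continuous_on \<O> B" "continuous_on \<O> A"
      using f_cont B_cont A_cont O_sub by (auto intro: continuous_on_subset)
    show "f x = A x *v x" "psd (P x)" "riccati (A x) (B x) Q R (P x) = 0" if "x \<in> \<O>" for x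
      using fA O_sub P that by auto
  qed
  let ?J = "\<lambda>y. \<integral>\<^sup>+t\<in>{0..}. ennreal \<bar>residual A B R P (y t)\<bar> \<partial>lebesgue"
  have V_val: "value_function f B Q R x = ennreal (V x)" "0 \<le> V x" if "x \<in> D" for x
    using V_finite that by (auto simp: V_def less_top[symmetric])
  have cont_V: "continuous_on D V"
    by (rule C1_on_imp_continuous_on[OF V_C1])
  have cont_ustar: "continuous_on D ustar"
    unfolding ustar_def feedback_def[abs_def]
    by (intro continuous_intros C1_on_grad[OF V_C1] continuous_on_subset[OF C1_on_imp_continuous_on[OF B_C1]]) auto
  \<comment> \<open>The zero control keeps the state at 0 free of cost. With continuity of V this
    makes the trapping threshold hold near 0.\<close>
  have V0: "V 0 = 0"
  proof -
    have "admissible (\<lambda>_. 0 :: real^'m)"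
      unfolding admissible_def by (intro conjI exI[of _ 0]) auto
    moreover have "state_trajectory f B 0 (\<lambda>_. 0) (\<lambda>_. 0)"
      by (auto simp: state_trajectory_def f0)
    ultimately have "value_function f B Q R 0 \<le> cost Q R (\<lambda>_. 0) (\<lambda>_. 0)"
      unfolding value_function_def by (intro Inf_lower) blast
    then show ?thesis
      by (simp add: V_def cost_def)
  qed
  have y0: "ystar x 0 = x"
    and yD: "\<And>t. t \<ge> 0 \<Longrightarrow> ystar x t \<in> D"
    and dy: "\<And>t. t \<ge> 0 \<Longrightarrow> (ystar x has_vector_derivative
       (f (ystar x t) + B (ystar x t) *v ustar (ystar x t))) (at t within {0..})"
    and opt: "(\<integral>\<^sup>+t\<in>{0..}. ennreal (cost_rate (ystar x t) (ustar (ystar x t))) \<partial>lebesgue) = ennreal (V x)"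
    if "x \<in> D" for x
  proof -
    have cl: "closed_loop_trajectory f B ustar D x (ystar x)"
      and co: "cost Q R (ystar x) (\<lambda>t. ustar (ystar x t)) = value_function f B Q R x"
      using ystar that by simp_all
    show "ystar x 0 = x" "\<And>t. t \<ge> 0 \<Longrightarrow> ystar x t \<in> D"
      "\<And>t. t \<ge> 0 \<Longrightarrow> (ystar x has_vector_derivative
         (f (ystar x t) + B (ystar x t) *v ustar (ystar x t))) (at t within {0..})"
      using cl by (simp_all add: closed_loop_trajectory_def)
    show "(\<integral>\<^sup>+t\<in>{0..}. ennreal (cost_rate (ystar x t) (ustar (ystar x t))) \<partial>lebesgue) = ennreal (V x)"
      using co unfolding V_val(1)[OF that] cost_def running_cost_def .
  qed
  have cont_w: "continuous_on {0..} (\<lambda>t. ustar (ystar x t))" if "x \<in> D" for x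
  proof (rule continuous_on_compose2[OF cont_ustar])
    show "continuous_on {0..} (ystar x)"
      by (rule continuous_on_vector_derivative) (use dy[OF that] in auto)
  qed (use yD[OF that] in auto)
  \<comment> \<open>Both parts rest on \<open>upper\<close> and \<open>lower\<close>. They differ in
    how \<open>ystar\<close> is kept in \<open>\<O>\<close> and brought near 0, and in how
    \<open>uS\<close> is bounded along its trajectory.\<close>
  have upper: "ennreal (sdre_value P x - V x) \<le> ?J (ystar x)"
    if x: "x \<in> D" and "\<And>t. t \<ge> 0 \<Longrightarrow> ystar x t \<in> \<O>"
      and "\<And>\<epsilon>. \<epsilon> > 0 \<Longrightarrow> \<exists>T\<ge>0. norm (ystar x T) < \<epsilon>" for x
  proof -
    have "ennreal (sdre_value P (ystar x 0) - V x) \<le> ?J (ystar x)"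
      by (rule VS_minus_cost_le[OF that(2) dy[OF x] cont_w[OF x] eq_refl[OF opt[OF x]] V_val(2)[OF x] that(3) \<O>(2)])
    then show ?thesis
      unfolding y0[OF x] .
  qed
  have lower: "ennreal (V x - sdre_value P x) \<le> ?J y"
    if "x \<in> D" and cl: "closed_loop_trajectory f B uS \<O> x y"
      and "\<And>t. t \<ge> 0 \<Longrightarrow> norm (uS (y t)) \<le> M" for x y M
  proof (cases "?J y")
    case (real e)
    have "x \<in> \<O>"
      using cl by (auto simp: closed_loop_trajectory_def)
    then have nonneg: "0 \<le> sdre_value P x"
      by (rule VS_nonneg)
    have "ennreal (V x) \<le> ennreal (sdre_value P x) + ?J y"
      using value_le_VS_plus[of x y M] that V_val(1)[of x] unfolding uS_def by simp
    then have "ennreal (V x) \<le> ennreal (sdre_value P x + e)"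
      using nonneg real by simp
    then have "V x \<le> sdre_value P x + e"
      using nonneg real(1) by (subst (asm) ennreal_le_iff) simp_all
    then show ?thesis
      unfolding real(2) by (intro ennreal_leI) simp
  qed simp
  obtain m a c k \<rho> where L: "lyapunov_data m a c k \<rho>"
    using lyapunov_data_exists[OF \<O>(2) Qhalf] detect \<O>(2) by blast
  then have \<rho>: "\<rho> > 0" "a > 0" "linear m" and ball: "cball 0 \<rho> \<subseteq> \<O>"
    by (auto simp: lyapunov_data_def)
  show ?thesis
  proof (intro conjI allI impI)
    have cont_m: "continuous_on S m" for S
      by (rule linear_continuous_on) (use \<rho>(3) linear_conv_bounded_linear in blast)
    have "m 0 = 0"
      using \<rho>(3) by (rule linear_0)
    \<comment> \<open>The thresholds for both kinds of trajectory, with V for the optimal one and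
      \<open>VS\<close> for the feedback; both left sides vanish at 0.\<close>
    have "\<forall>\<^sub>F x in nhds 0. x \<in> \<O> \<and> x \<in> D \<and> norm x < \<rho> \<and>
        x \<bullet> m x + k * V x < a * \<rho>\<^sup>2 \<and> x \<bullet> m x + k * sdre_value P x < a * \<rho>\<^sup>2"
      using \<rho>(1,2) V0 \<open>m 0 = 0\<close> \<O> D
      by (intro eventually_conj eventually_nhds_in_open
          eventually_less_of_continuous_on[of UNIV norm] eventually_less_of_continuous_on[of D "\<lambda>x. x \<bullet> m x + k * V x"]
          eventually_less_of_continuous_on[of \<O> "\<lambda>x. x \<bullet> m x + k * sdre_value P x"]
          continuous_intros cont_m cont_V cont_VS) (auto simp: sdre_value_def)
    then obtain N where N: "open N" "0 \<in> N" and near: "\<And>x. x \<in> N \<Longrightarrow> x \<in> \<O> \<and> x \<in> D \<and> norm x < \<rho> \<and>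
        x \<bullet> m x + k * V x < a * \<rho>\<^sup>2 \<and> x \<bullet> m x + k * sdre_value P x < a * \<rho>\<^sup>2"
      unfolding eventually_nhds by blast
    show "\<exists>N. open N \<and> 0 \<in> N \<and> N \<subseteq> \<O> \<inter> D \<and>
       (\<forall>x\<in>N.
          (\<forall>t\<ge>0. ystar x t \<in> \<O>) \<and>
          (\<exists>yS. closed_loop_trajectory f B uS \<O> x yS) \<and>
          (\<forall>yS. closed_loop_trajectory f B uS \<O> x yS \<longrightarrow>
             ennreal \<bar>sdre_value P x - V x\<bar> \<le>
               max (\<integral>\<^sup>+t\<in>{0..}. ennreal \<bar>E (ystar x t)\<bar> \<partial>lebesgue)
                   (\<integral>\<^sup>+t\<in>{0..}. ennreal \<bar>E (yS t)\<bar> \<partial>lebesgue)))"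
    proof (intro exI[of _ N] conjI ballI N subsetI)
      fix x assume "x \<in> N"
      then have x: "x \<in> \<O>" "x \<in> D" "norm x < \<rho>" "x \<bullet> m x + k * V x < a * \<rho>\<^sup>2"
          "x \<bullet> m x + k * sdre_value P x < a * \<rho>\<^sup>2"
        using near by auto
      then show "x \<in> \<O> \<inter> D"
        by blast
      have cont_y: "continuous_on {0..} (ystar x)"
        by (rule continuous_on_vector_derivative) (use dy[OF x(2)] in auto)
      have cost: "integral {0..T} (\<lambda>t. cost_rate (ystar x t) (ustar (ystar x t))) \<le> V x" for T
      proof -
        have "ennreal (integral {0..T} (\<lambda>t. cost_rate (ystar x t) (ustar (ystar x t)))) \<le> ennreal (V x)"
          unfolding opt[OF x(2), symmetric]
          by (intro set_nn_integral_atLeast_ge cont_cost_rate cont_y cont_w[OF x(2)] running_cost_nonneg Q R)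
        then show ?thesis
          using V_val(2)[OF x(2)] by (simp only: ennreal_le_iff)
      qed
      have trapped: "\<And>t. t \<ge> 0 \<Longrightarrow> norm (ystar x t) < \<rho>" "\<And>\<epsilon>. \<epsilon> > 0 \<Longrightarrow> \<exists>T\<ge>0. norm (ystar x T) < \<epsilon>"
        using trapped_trajectory[OF L dy[OF x(2)] cont_w[OF x(2)] cost] x(3,4) y0[OF x(2)] by simp_all
      show in_O: "\<forall>t\<ge>0. ystar x t \<in> \<O>"
      proof (intro allI impI)
        fix t :: real assume "t \<ge> 0"
        then have "ystar x t \<in> cball 0 \<rho>"
          using trapped(1)[of t] by simp
        then show "ystar x t \<in> \<O>"
          using ball by blast
      qed
      show "\<exists>yS. closed_loop_trajectory f B uS \<O> x yS"
        using feedback_solution_exists[OF L x(3,5)] unfolding uS_def by blast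
      show "\<forall>yS. closed_loop_trajectory f B uS \<O> x yS \<longrightarrow>
             ennreal \<bar>sdre_value P x - V x\<bar> \<le>
               max (\<integral>\<^sup>+t\<in>{0..}. ennreal \<bar>E (ystar x t)\<bar> \<partial>lebesgue)
                   (\<integral>\<^sup>+t\<in>{0..}. ennreal \<bar>E (yS t)\<bar> \<partial>lebesgue)"
      proof (intro allI impI)
        fix yS assume cl: "closed_loop_trajectory f B uS \<O> x yS"
        have "norm (yS t) \<le> \<rho>" if "t \<ge> 0" for t
          using closed_loop_norm_less[OF L cl[unfolded uS_def] x(3,5) that] by simp
        \<comment> \<open>The trajectory is in the ball from the start, so the initial interval ends
          at time 0.\<close>
        then obtain M where "\<And>t. t \<ge> 0 \<Longrightarrow> norm (uS (yS t)) \<le> M"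
          using feedback_bounded[OF cl[unfolded uS_def] ball, of 0] unfolding uS_def by blast
        then show "ennreal \<bar>sdre_value P x - V x\<bar> \<le>
               max (\<integral>\<^sup>+t\<in>{0..}. ennreal \<bar>E (ystar x t)\<bar> \<partial>lebesgue)
                   (\<integral>\<^sup>+t\<in>{0..}. ennreal \<bar>E (yS t)\<bar> \<partial>lebesgue)"
          unfolding E_def using in_O trapped(2)
          by (intro ennreal_abs_diff_le_max upper[OF x(2)] lower[OF x(2) cl]) auto
      qed
    qed
  next
    fix \<Omega> :: "(real^'d) set" and yS :: "real^'d \<Rightarrow> real \<Rightarrow> real^'d" and C\<^sub>0 lam :: real
    assume "0 \<in> interior \<Omega> \<and> \<Omega> \<subseteq> \<O> \<inter> D \<and> C\<^sub>0 > 0 \<and> lam > 0 \<and>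
        (\<forall>x\<in>\<Omega>. closed_loop_trajectory f B uS \<Omega> x (yS x) \<and>
           (\<forall>t\<ge>0. ystar x t \<in> \<Omega> \<and>
              norm (ystar x t) \<le> C\<^sub>0 * exp (- lam * t) * norm x \<and>
              norm (yS x t) \<le> C\<^sub>0 * exp (- lam * t) * norm x))"
    then have \<Omega>: "\<Omega> \<subseteq> \<O>" "\<Omega> \<subseteq> D" and C\<^sub>0: "C\<^sub>0 > 0" and lam: "lam > 0"
      and clS: "\<And>x. x \<in> \<Omega> \<Longrightarrow> closed_loop_trajectory f B uS \<Omega> x (yS x)"
      and ystar_decay: "\<And>x t. x \<in> \<Omega> \<Longrightarrow> t \<ge> 0 \<Longrightarrow> ystar x t \<in> \<Omega> \<and> norm (ystar x t) \<le> C\<^sub>0 * exp (- lam * t) * norm x"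
      and yS_decay: "\<And>x t. x \<in> \<Omega> \<Longrightarrow> t \<ge> 0 \<Longrightarrow> norm (yS x t) \<le> C\<^sub>0 * exp (- lam * t) * norm x"
      by auto
    show "\<exists>C>0. \<forall>x\<in>\<Omega>. ennreal \<bar>sdre_value P x - V x\<bar>
                 \<le> ennreal (C / lam) * weighted_sup \<Omega> E * ennreal (norm x)"
    \<comment> \<open>The overshoot constant \<open>C\<^sub>0\<close> itself serves as C.\<close>
    proof (intro exI[of _ C\<^sub>0] conjI C\<^sub>0 ballI)
      fix x assume x: "x \<in> \<Omega>"
      then have xD: "x \<in> D"
        using \<Omega> by blast
      have yS_\<Omega>: "yS x t \<in> \<Omega>" if "t \<ge> 0" for t
        using clS[OF x] that by (auto simp: closed_loop_trajectory_def)
      have clS_O: "closed_loop_trajectory f B uS \<O> x (yS x)"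
        using clS[OF x] \<Omega>(1) by (auto simp: closed_loop_trajectory_def)
      \<comment> \<open>Exponential decay takes over the role of trapping: it brings
        \<open>ystar\<close> near 0 and eventually puts \<open>yS\<close> into the ball where
        \<open>uS\<close> is bounded.\<close>
      have late: "\<exists>T\<ge>0. \<forall>t\<ge>T. C\<^sub>0 * exp (- lam * t) * norm x < \<epsilon>" if "\<epsilon> > 0" for \<epsilon>
        using exp_decay_less[OF lam that, of "C\<^sub>0 * norm x"] C\<^sub>0 by (simp add: mult_ac) blast
      obtain T where T: "T \<ge> 0" "\<And>t. t \<ge> T \<Longrightarrow> C\<^sub>0 * exp (- lam * t) * norm x < \<rho>"
        using late[OF \<rho>(1)] by blast
      have "norm (yS x t) \<le> \<rho>" if "t \<ge> T" for t
        using yS_decay[OF x, of t] T(1) T(2)[OF that] that by linarith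
      then obtain M where M: "\<And>t. t \<ge> 0 \<Longrightarrow> norm (uS (yS x t)) \<le> M"
        using feedback_bounded[OF clS_O[unfolded uS_def] ball, of T] unfolding uS_def by blast
      have "ennreal (sdre_value P x - V x) \<le> ?J (ystar x)"
      proof (rule upper[OF xD])
        show "\<exists>T\<ge>0. norm (ystar x T) < \<epsilon>" if "\<epsilon> > 0" for \<epsilon>
          using late[OF that] ystar_decay[OF x] by (meson le_less_trans order_refl)
      qed (use ystar_decay[OF x] \<Omega>(1) in blast)
      moreover have "ennreal (V x - sdre_value P x) \<le> ?J (yS x)"
        by (rule lower[OF xD clS_O M])
      ultimately have "ennreal \<bar>sdre_value P x - V x\<bar> \<le> max (?J (ystar x)) (?J (yS x))"
        by (rule ennreal_abs_diff_le_max)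
      also have "\<dots> \<le> ennreal (C\<^sub>0 / lam) * weighted_sup \<Omega> E * ennreal (norm x)"
        unfolding E_def using ystar_decay[OF x] yS_decay[OF x] yS_\<Omega>
        by (intro max.boundedI nn_integral_exp_bound lam C\<^sub>0 E_0) auto
      finally show "ennreal \<bar>sdre_value P x - V x\<bar>
          \<le> ennreal (C\<^sub>0 / lam) * weighted_sup \<Omega> E * ennreal (norm x)" .
    qed
  qed
qed

end
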